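(* Let $0<\beta<1$. For $\delta>0$, $\kappa\in\mathbb R$ and $s>0$ let $\widehat{\widetilde q}_\delta(\kappa,s)$ be the solution of $$s^{\beta-1}\left[s\,\widehat{\widetilde q}_\delta(\kappa,s)-1\right]=\delta^{-1}\left[\exp(i\kappa\delta)-1\right]\widehat{\widetilde q}_\delta(\kappa,s),$$ the Fourier-Laplace equation of the Mittag-Leffler renewal process (fractional Poisson process) with its counting steps rescaled by $\delta$ and accelerated by the factor $\delta^{-1}$. Then for all fixed $\kappa\in\mathbb R$ and $s>0$, $$\lim_{\delta\to0^+}\widehat{\widetilde q}_\delta(\kappa,s)=\widehat{\widetilde q}_0(\kappa,s):=\frac{s^{\beta-1}}{s^\beta-i\kappa}.$$ The limit satisfies $s^{\beta-1}\left[s\,\widehat{\widetilde q}_0(\kappa,s)-1\right]=i\kappa\,\widehat{\widetilde q}_0(\kappa,s)$, which is the Fourier-Laplace form of the Cauchy problem for the positively oriented time-fractional drift equation $${}_tD_*^\beta q_0(r,t)=-\frac{\partial}{\partial r}q_0(r,t),\qquad q_0(r,0)=\delta(r),$$ and Fourier inversion in $\kappa$ gives $$\widetilde q_0(r,s)=\begin{cases}s^{\beta-1}\exp(-r s^\beta), & r>0,\\ 0, & r<0.\end{cases}$$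
   Context: Transforms: $\widehat f(\kappa)=\int_{-\infty}^{\infty}e^{i\kappa r}f(r)\,dr$ and $\widetilde g(s)=\int_0^\infty e^{-st}g(t)\,dt$; $\widehat{\widetilde q}(\kappa,s)$ is the Fourier transform in $r$ and the Laplace transform in $t$. In the initial condition, $\delta(r)$ is the Dirac delta; elsewhere $\delta$ is the positive scaling parameter. The Mittag-Leffler renewal process (fractional Poisson process) of order $\beta$ is the renewal process with i.i.d. waiting times of density $\phi_\beta^{ML}(t)=-\frac{d}{dt}E_\beta(-t^\beta)$, where $E_\beta(z)=\sum_{n\ge0}z^n/\Gamma(1+\beta n)$; its waiting-time Laplace transform is $1/(1+s^\beta)$. Regarding its counting number $N(t)=\max\{k: t_k\le t\}$ (with $t_k$ the sum of the first $k$ waiting times) as the position of a continuous time random walk with all jumps equal to $1$, its sojourn density $q(r,t)$ satisfies $s^{\beta-1}[s\widehat{\widetilde q}(\kappa,s)-1]=[\exp(i\kappa)-1]\widehat{\widetilde q}(\kappa,s)$. Replacing jumps of size $1$ by jumps of size $\delta$ and multiplying the right-hand side by $\delta^{-1}$ gives the equation for $\widehat{\widetilde q}_\delta$. For $0<\beta<1$, ${}_tD_*^\beta$ is the Caputo derivative ${}_tD_*^\beta g(t)=\frac{1}{\Gamma(1-\beta)}\frac{d}{dt}\int_0^t\frac{g(t')}{(t-t')^\beta}dt'-\frac{g(0)t^{-\beta}}{\Gamma(1-\beta)}$, whose Laplace transform is $s^\beta\widetilde g(s)-s^{\beta-1}g(0)$. *)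

theory Defs
  imports "HOL-Probability.Probability"
begin

definition laplace :: "(real \<Rightarrow> 'a::{banach, second_countable_topology}) \<Rightarrow> real \<Rightarrow> 'a" where
  "laplace g s = (LINT t:{0..}|lborel. exp (- s * t) *\<^sub>R g t)"

text \<open>
  The Fourier-Laplace transform of a family of measures on the line, \<open>Q t\<close> being the law of the
  position at time \<open>t\<close>.  The library's \<open>char\<close> has the sign convention \<open>exp (\<i> \<kappa> r)\<close>.
\<close>
definition fourier_laplace :: "(real \<Rightarrow> real measure) \<Rightarrow> real \<Rightarrow> real \<Rightarrow> complex" where
  "fourier_laplace Q \<kappa> s = laplace (\<lambda>t. char (Q t) \<kappa>) s"

definition caputo_integral :: "real \<Rightarrow> (real \<Rightarrow> real) \<Rightarrow> real \<Rightarrow> real" where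
  "caputo_integral \<beta> g t = (LINT u:{0..t}|lborel. g u / (t - u) powr \<beta>)"

definition caputo_differentiable :: "real \<Rightarrow> (real \<Rightarrow> real) \<Rightarrow> real \<Rightarrow> bool" where
  "caputo_differentiable \<beta> g t \<longleftrightarrow> caputo_integral \<beta> g differentiable (at t)"

definition caputo_deriv :: "real \<Rightarrow> (real \<Rightarrow> real) \<Rightarrow> real \<Rightarrow> real" where
  "caputo_deriv \<beta> g t =
     1 / Gamma (1 - \<beta>) * deriv (caputo_integral \<beta> g) t - g 0 * t powr (- \<beta>) / Gamma (1 - \<beta>)"

definition test_function :: "(real \<Rightarrow> real) \<Rightarrow> bool" where
  "test_function \<phi> \<longleftrightarrow>
     (\<forall>n x. (deriv ^^ n) \<phi> differentiable (at x)) \<and> compact (closure {x. \<phi> x \<noteq> 0})"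

text \<open>
  Since the initial value is a Dirac mass, \<open>q(\<cdot>, t)\<close> is modelled as a finite Borel measure
  depending weakly continuously on \<open>t \<ge> 0\<close>.  Neither a normalisation nor a growth condition in
  \<open>t\<close> is imposed.
\<close>
definition weakly_continuous_family :: "(real \<Rightarrow> real measure) \<Rightarrow> bool" where
  "weakly_continuous_family Q \<longleftrightarrow>
     (\<forall>t\<ge>0. finite_measure (Q t) \<and> sets (Q t) = sets borel) \<and>
     (\<forall>f :: real \<Rightarrow> real. continuous_on UNIV f \<and> bounded (range f) \<longrightarrow>
        continuous_on {0..} (\<lambda>t. LINT r|Q t. f r))"

text \<open>
  The Cauchy problem \<open>D\<^sub>*\<^sup>\<beta> q = - \<partial>q/\<partial>r\<close>, \<open>q(r, 0) = \<delta>(r)\<close>, where \<open>r\<close>-derivatives are taken in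
  the sense of distributions: pairing \<open>- \<partial>q/\<partial>r\<close> with \<open>\<phi>\<close> gives the integral of \<open>\<phi>'\<close>.
\<close>
definition solves_fractional_drift :: "real \<Rightarrow> (real \<Rightarrow> real measure) \<Rightarrow> bool" where
  "solves_fractional_drift \<beta> Q \<longleftrightarrow>
     (\<forall>\<phi>. test_function \<phi> \<longrightarrow> (\<forall>t>0.
        caputo_differentiable \<beta> (\<lambda>\<tau>. LINT r|Q \<tau>. \<phi> r) t \<and>
        caputo_deriv \<beta> (\<lambda>\<tau>. LINT r|Q \<tau>. \<phi> r) t = (LINT r|Q t. deriv \<phi> r))) \<and>
     Q 0 = return borel 0"

definition scaled_renewal_eq :: "real \<Rightarrow> real \<Rightarrow> real \<Rightarrow> real \<Rightarrow> complex \<Rightarrow> bool" where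
  "scaled_renewal_eq \<beta> \<delta> \<kappa> s q \<longleftrightarrow>
     of_real (s powr (\<beta> - 1)) * (of_real s * q - 1) =
     inverse (of_real \<delta>) * (exp (\<i> * of_real \<kappa> * of_real \<delta>) - 1) * q"

definition drift_eq :: "real \<Rightarrow> real \<Rightarrow> real \<Rightarrow> complex \<Rightarrow> bool" where
  "drift_eq \<beta> \<kappa> s q \<longleftrightarrow>
     of_real (s powr (\<beta> - 1)) * (of_real s * q - 1) = \<i> * of_real \<kappa> * q"

definition q0_hat :: "real \<Rightarrow> real \<Rightarrow> real \<Rightarrow> complex" where
  "q0_hat \<beta> \<kappa> s = of_real (s powr (\<beta> - 1)) / (of_real (s powr \<beta>) - \<i> * of_real \<kappa>)"

text \<open>The value at \<open>r = 0\<close> is immaterial and set to 0.\<close>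
definition q0_tilde :: "real \<Rightarrow> real \<Rightarrow> real \<Rightarrow> real" where
  "q0_tilde \<beta> r s = (if r > 0 then s powr (\<beta> - 1) * exp (- r * s powr \<beta>) else 0)"

text \<open>
  Fourier inversion at the point \<open>r\<close>, as a symmetric improper integral: transforms such as
  \<open>\<kappa> \<mapsto> q0_hat \<beta> \<kappa> s\<close> are not absolutely integrable.
\<close>
definition has_fourier_inverse :: "(real \<Rightarrow> complex) \<Rightarrow> real \<Rightarrow> complex \<Rightarrow> bool" where
  "has_fourier_inverse F r v \<longleftrightarrow>
     ((\<lambda>R. 1 / (2 * of_real pi) *
           (CLINT \<kappa>:{-R..R}|lborel. exp (- \<i> * of_real \<kappa> * of_real r) * F \<kappa>)) \<longlongrightarrow> v) at_top"

end

theory Submission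
  imports Defs
begin

text \<open>
  The renewal equation and the drift equation are linear in the unknown with a nonvanishing
  coefficient (\<open>scaled_renewal_eq_iff\<close>, \<open>drift_eq_iff\<close>): the symbol \<open>(exp (\<i> \<kappa> \<delta>) - 1) / \<delta>\<close> has
  nonpositive real part while \<open>s powr \<beta> > 0\<close>.  As \<open>\<delta>\<close> tends to \<open>0\<close> the symbol tends to the derivative
  \<open>\<i> \<kappa>\<close>, and the explicit solutions converge with it.

  The substance is the equivalence of the Cauchy problem with its Fourier-Laplace form.  The
  Caputo equation for a pairing \<open>g\<close> with right-hand side \<open>h\<close> is first integrated once in time, to
  \<open>I\<^sub>\<beta> (g - g 0) = \<Gamma>(1 - \<beta>) I\<^sub>0 h\<close> with \<open>I\<^sub>\<alpha> = caputo_integral \<alpha>\<close>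
  (\<open>caputo_iff_integrated\<close>).  Both sides are continuous, and \<open>I\<^sub>\<alpha>\<close> multiplies Laplace transforms by
  \<open>\<Gamma>(1 - \<alpha>) s powr (\<alpha> - 1)\<close>, so uniqueness of Laplace transforms makes this the same as
  \<open>s powr \<beta> * laplace g s - s powr (\<beta> - 1) * g 0 = laplace h s\<close> for all \<open>s > 0\<close>
  (\<open>integrated_iff_laplace\<close>).

  Given a solution \<open>Q\<close>, smooth cutoffs extend the integrated equation from test functions to
  bounded trigonometric functions.  The constant function \<open>1\<close> shows that \<open>I\<^sub>\<beta>\<close> of the total mass
  equals \<open>I\<^sub>\<beta> 1\<close>; as the mass is nonnegative, this forces its Laplace transform to converge,
  and then the mass is \<open>1\<close> at all times.  The functions \<open>cos (\<kappa> r)\<close> and \<open>sin (\<kappa> r)\<close> give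
  the transformed equation (\<open>solves_imp_drift_eq\<close>).

  Conversely, let the transformed equation hold.  Frequency \<open>0\<close> gives mass \<open>1\<close>.  The
  position at an independent exponential time of rate \<open>s\<close> then has characteristic function
  \<open>a / (a - \<i> \<kappa>)\<close> with \<open>a = s powr \<beta>\<close>, hence is itself exponential of rate \<open>a\<close>
  (\<open>time_mixture_eq_exponential\<close>).  This one identity of laws gives the Laplace transform of
  \<open>Q t A\<close>, the initial value (let \<open>s\<close> tend to infinity), and, by the rule for the transform of a
  space derivative, the equation for every test function (\<open>drift_eq_imp_solves\<close>).

  The Fourier inversion compares Levy's inversion formula for the exponential law and for the
  Dirac mass at \<open>0\<close>: by partial fractions, their difference is a difference of two values of the wanted
  integral, and one of the two points can be sent to infinity.
\<close>

section \<open>Laplace transforms of Caputo integrals\<close>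

lemma convolution_integral:
  fixes a b :: "real \<Rightarrow> real"
  assumes a: "integrable lborel a" and b: "integrable lborel b"
  shows "integrable lborel (\<lambda>t. LINT u|lborel. a u * b (t - u))" (is ?I)
    and "(LINT t|lborel. LINT u|lborel. a u * b (t - u)) = (LINT u|lborel. a u) * (LINT x|lborel. b x)"
proof -
  have [measurable]: "a \<in> borel_measurable borel" "b \<in> borel_measurable borel"
    using a b by auto
  have shift: "integrable lborel (\<lambda>t. c (t - u))"
    "(LINT t|lborel. c (t - u)) = (LINT x|lborel. c x)" if "integrable lborel c" for u and c :: "real \<Rightarrow> real"
    using lborel_integrable_real_affine[of c 1 "-u"] lborel_integral_real_affine[of 1 c "-u"] that
    by (auto simp: algebra_simps)
  have int: "integrable (lborel \<Otimes>\<^sub>M lborel) (\<lambda>(u, t). a u * b (t - u))"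
  proof (rule lborel_pair.Fubini_integrable)
    have "(LINT t|lborel. norm (a u * b (t - u))) = \<bar>a u\<bar> * (LINT x|lborel. \<bar>b x\<bar>)" for u
      using shift(2)[of "\<lambda>x. \<bar>b x\<bar>" u] b by (simp add: abs_mult)
    then show "integrable lborel (\<lambda>x. LINT y|lborel. norm (case (x, y) of (u, t) \<Rightarrow> a u * b (t - u)))"
      using a by simp
    show "AE x in lborel. integrable lborel (\<lambda>y. case (x, y) of (u, t) \<Rightarrow> a u * b (t - u))"
      using shift(1)[OF b] by auto
  qed measurable
  have "(LINT t|lborel. LINT u|lborel. a u * b (t - u)) = (LINT u|lborel. LINT t|lborel. a u * b (t - u))"
    using lborel_pair.Fubini_integral[of "\<lambda>u t. a u * b (t - u)"] int by simp
  also have "\<dots> = (LINT u|lborel. a u) * (LINT x|lborel. b x)"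
    using shift(2)[OF b] by simp
  finally show "(LINT t|lborel. LINT u|lborel. a u * b (t - u)) = (LINT u|lborel. a u) * (LINT x|lborel. b x)" .
  show ?I
    using lborel_pair.integrable_snd[of "\<lambda>u t. a u * b (t - u)"] int by simp
qed

lemma gamma_integral_scaled:
  fixes \<alpha> s :: real
  assumes "\<alpha> < 1" "s > 0"
  shows "has_bochner_integral lborel (\<lambda>x. indicator {0..} x * (exp (- s * x) / x powr \<alpha>))
           (Gamma (1 - \<alpha>) * s powr (\<alpha> - 1))"
proof -
  let ?f = "\<lambda>t::real. indicator {0..} t * t powr (- \<alpha>) / exp t"
  have "(\<integral>\<^sup>+t. ennreal (?f t) \<partial>lborel) = ennreal (Gamma (1 - \<alpha>))"
    using Gamma_conv_nn_integral_real[of "1 - \<alpha>"] assms by simp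
  then have "has_bochner_integral lborel ?f (Gamma (1 - \<alpha>))"
    using assms by (intro has_bochner_integral_nn_integral) (auto intro!: Gamma_real_nonneg)
  then have *: "integrable lborel ?f" "(LINT t|lborel. ?f t) = Gamma (1 - \<alpha>)"
    by (auto simp: has_bochner_integral_iff)
  have eq: "?f (0 + s * x) = s powr (- \<alpha>) * (indicator {0..} x * (exp (- s * x) / x powr \<alpha>))" for x
    using assms by (auto simp: indicator_def powr_mult powr_minus exp_minus field_simps zero_le_mult_iff)
  have "integrable lborel (\<lambda>x. ?f (0 + s * x))"
    by (rule lborel_integrable_real_affine) (use * assms in auto)
  then have 1: "integrable lborel (\<lambda>x. indicator {0..} x * (exp (- s * x) / x powr \<alpha>))"
    unfolding eq using assms by (simp del: times_divide_eq_right times_divide_eq_left)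
  have "Gamma (1 - \<alpha>) = \<bar>s\<bar> *\<^sub>R (LINT x|lborel. ?f (0 + s * x))"
    using lborel_integral_real_affine[of s ?f 0] * assms by simp
  also have "\<dots> = s * s powr (- \<alpha>) * (LINT x|lborel. indicator {0..} x * (exp (- s * x) / x powr \<alpha>))"
    unfolding eq using assms by (simp del: times_divide_eq_right times_divide_eq_left)
  also have "s * s powr (- \<alpha>) = s powr (1 - \<alpha>)"
    using assms by (simp add: powr_diff powr_minus field_simps)
  finally have "(LINT x|lborel. indicator {0..} x * (exp (- s * x) / x powr \<alpha>)) = Gamma (1 - \<alpha>) / s powr (1 - \<alpha>)"
    using assms by (simp add: field_simps)
  also have "\<dots> = Gamma (1 - \<alpha>) * s powr (\<alpha> - 1)"
    using assms powr_minus[of s "1 - \<alpha>"] by (simp add: divide_simps)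
  finally show ?thesis
    using 1 by (simp add: has_bochner_integral_iff)
qed

definition laplace_integrable :: "(real \<Rightarrow> 'a::{banach, second_countable_topology}) \<Rightarrow> real \<Rightarrow> bool" where
  "laplace_integrable g s \<longleftrightarrow> set_integrable lborel {0..} (\<lambda>t. exp (- s * t) *\<^sub>R g t)"

text \<open>
  Since \<open>exp (- s t) = exp (- s u) exp (- s (t - u))\<close>, the weighted Caputo integral is the convolution
  of two integrable functions, and the second one contributes a Gamma integral.
\<close>
lemma laplace_caputo_integral:
  fixes g :: "real \<Rightarrow> real"
  assumes g: "laplace_integrable g s" and s: "s > 0" and \<alpha>: "\<alpha> < 1"
  shows "laplace_integrable (caputo_integral \<alpha> g) s"
    and "laplace (caputo_integral \<alpha> g) s = Gamma (1 - \<alpha>) * s powr (\<alpha> - 1) * laplace g s"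
proof -
  let ?a = "\<lambda>u. indicator {0..} u * (exp (- s * u) * g u)"
  let ?b = "\<lambda>x. indicator {0..} x * (exp (- s * x) / x powr \<alpha>)"
  have a: "integrable lborel ?a"
    using g by (simp add: laplace_integrable_def set_integrable_def)
  have b: "integrable lborel ?b" "(LINT x|lborel. ?b x) = Gamma (1 - \<alpha>) * s powr (\<alpha> - 1)"
    using gamma_integral_scaled[OF \<alpha> s] by (auto simp: has_bochner_integral_iff)
  have eq: "indicator {0..} t *\<^sub>R exp (- s * t) *\<^sub>R caputo_integral \<alpha> g t = (LINT u|lborel. ?a u * ?b (t - u))" for t
  proof -
    have "?a u * ?b (t - u) = (indicator {0..} t * exp (- s * t)) * (indicator {0..t} u *\<^sub>R (g u / (t - u) powr \<alpha>))" for u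
      by (auto simp: indicator_def exp_diff exp_minus field_simps)
    then show ?thesis
      unfolding caputo_integral_def set_lebesgue_integral_def
      by (simp del: times_divide_eq_right times_divide_eq_left)
  qed
  show "laplace_integrable (caputo_integral \<alpha> g) s"
    unfolding laplace_integrable_def set_integrable_def eq
    by (rule convolution_integral(1)[OF a b(1)])
  show "laplace (caputo_integral \<alpha> g) s = Gamma (1 - \<alpha>) * s powr (\<alpha> - 1) * laplace g s"
    unfolding laplace_def set_lebesgue_integral_def eq convolution_integral(2)[OF a b(1)] b(2)
    by simp
qed

lemma integrable_beta_kernel:
  assumes "\<alpha> < (1::real)"
  shows "integrable lborel (\<lambda>v. indicator {0..1} v / (1 - v) powr \<alpha>)"
    and "(LINT v|lborel. indicator {0..1} v / (1 - v) powr \<alpha>) = 1 / (1 - \<alpha>)"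
proof -
  have "((\<lambda>x. x powr (- \<alpha>)) has_integral inverse (1 - \<alpha>) * 1 powr (1 - \<alpha>) - inverse (1 - \<alpha>) * 0 powr (1 - \<alpha>)) {0..(1::real)}"
  proof (rule fundamental_theorem_of_calculus_interior)
    show "continuous_on {0..1} (\<lambda>x. inverse (1 - \<alpha>) * x powr (1 - \<alpha>))"
      using assms by (intro continuous_intros continuous_on_powr') auto
    show "((\<lambda>x. inverse (1 - \<alpha>) * x powr (1 - \<alpha>)) has_vector_derivative x powr - \<alpha>) (at x)" if "x \<in> {0<..<1}" for x
      using that assms by (auto intro!: derivative_eq_intros simp: has_real_derivative_iff_has_vector_derivative[symmetric])
  qed auto
  then have hi: "((\<lambda>x. x powr (- \<alpha>)) has_integral 1 / (1 - \<alpha>)) {0..(1::real)}"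
    using assms by (simp add: inverse_eq_divide)
  have "(\<integral>\<^sup>+x. ennreal (indicator {0..1} x * x powr (- \<alpha>)) \<partial>lborel) = ennreal (1 / (1 - \<alpha>))"
    using nn_integral_has_integral_lebesgue[OF _ hi] by simp
  then have "has_bochner_integral lborel (\<lambda>x. indicator {0..1} x * x powr (- \<alpha>)) (1 / (1 - \<alpha>))"
    using assms by (intro has_bochner_integral_nn_integral) auto
  then have *: "integrable lborel (\<lambda>x. indicator {0..1} x * x powr (- \<alpha>))" "(LINT x|lborel. indicator {0..1} x * x powr (- \<alpha>)) = 1 / (1 - \<alpha>)"
    by (auto simp: has_bochner_integral_iff)
  have eq: "indicator {0..1} (1 + (-1) * v) * (1 + (-1) * v) powr (- \<alpha>) = indicator {0..1} v / (1 - v) powr \<alpha>" for v :: real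
    by (auto simp: indicator_def powr_minus field_simps)
  show "integrable lborel (\<lambda>v. indicator {0..1} v / (1 - v) powr \<alpha>)"
    using lborel_integrable_real_affine[OF *(1), of "-1" 1] unfolding eq by simp
  show "(LINT v|lborel. indicator {0..1} v / (1 - v) powr \<alpha>) = 1 / (1 - \<alpha>)"
    using lborel_integral_real_affine[of "-1" "\<lambda>x. indicator {0..1} x * x powr (- \<alpha>)" 1] *(2)
    unfolding eq by simp
qed

text \<open>
  Substituting \<open>u = t v\<close> fixes the domain and the kernel, so that only \<open>g (t v)\<close> depends on time and
  dominated convergence applies.
\<close>
lemma caputo_integral_scaled:
  assumes "t \<ge> 0" "\<alpha> < 1"
  shows "caputo_integral \<alpha> g t = t powr (1 - \<alpha>) * (LINT v|lborel. indicator {0..1} v / (1 - v) powr \<alpha> * g (t * v))"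
proof (cases "t = 0")
  case True
  have "(LINT u|lborel. indicator {0..0} u *\<^sub>R (g u / (0 - u) powr \<alpha>)) = (LINT u::real|lborel. (0::real))"
    by (rule Bochner_Integration.integral_cong) (auto simp: indicator_def)
  then show ?thesis
    using True by (simp add: caputo_integral_def set_lebesgue_integral_def)
next
  case False
  with assms have t: "t > 0" by simp
  have "caputo_integral \<alpha> g t = \<bar>t\<bar> *\<^sub>R (LINT v|lborel. indicator {0..t} (0 + t * v) *\<^sub>R (g (0 + t * v) / (t - (0 + t * v)) powr \<alpha>))"
    unfolding caputo_integral_def set_lebesgue_integral_def using t
    by (intro lborel_integral_real_affine) auto
  also have "\<dots> = t * (LINT v|lborel. t powr (- \<alpha>) * (indicator {0..1} v / (1 - v) powr \<alpha> * g (t * v)))"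
  proof -
    have "(t - t * v) powr \<alpha> = t powr \<alpha> * (1 - v) powr \<alpha>" if "v \<le> 1" for v
      using t that powr_mult[of t "1 - v" \<alpha>] by (simp add: algebra_simps)
    then have "indicator {0..t} (0 + t * v) *\<^sub>R (g (0 + t * v) / (t - (0 + t * v)) powr \<alpha>) =
      t powr (- \<alpha>) * (indicator {0..1} v / (1 - v) powr \<alpha> * g (t * v))" for v
      using t by (auto simp: indicator_def powr_minus divide_simps zero_le_mult_iff)
    then show ?thesis using t by (simp del: times_divide_eq_right times_divide_eq_left)
  qed
  also have "\<dots> = t powr (1 - \<alpha>) * (LINT v|lborel. indicator {0..1} v / (1 - v) powr \<alpha> * g (t * v))"
    using t by (simp only: integral_mult_right_zero) (simp add: powr_diff powr_minus_divide)
  finally show ?thesis .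
qed

lemma caputo_integral_const:
  assumes "t \<ge> 0" "\<alpha> < 1"
  shows "caputo_integral \<alpha> (\<lambda>_. c) t = c * t powr (1 - \<alpha>) / (1 - \<alpha>)"
  unfolding caputo_integral_scaled[OF assms] using integrable_beta_kernel[OF assms(2)]
  by (simp del: times_divide_eq_right times_divide_eq_left) (simp add: mult.commute)

lemma integrable_caputo_scaled:
  fixes g :: "real \<Rightarrow> real"
  assumes g: "continuous_on {0..} g" and "t \<ge> 0" "\<alpha> < 1"
  shows "integrable lborel (\<lambda>v. indicator {0..1} v / (1 - v) powr \<alpha> * g (t * v))"
proof -
  have "continuous_on {0..1} (\<lambda>v. g (t * v))"
    using \<open>t \<ge> 0\<close> by (intro continuous_on_compose2[OF g] continuous_intros) auto
  then have m: "(\<lambda>v. indicator {0..1} v *\<^sub>R g (t * v)) \<in> borel_measurable borel"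
    by (intro borel_measurable_continuous_on_indicator) auto
  have "bounded (g ` {0..t})"
    by (intro compact_imp_bounded compact_continuous_image continuous_on_subset[OF g]) auto
  then obtain B where B: "\<And>x. x \<in> {0..t} \<Longrightarrow> \<bar>g x\<bar> \<le> B"
    by (fastforce simp: bounded_iff)
  have "integrable lborel (\<lambda>v. (indicator {0..1} v / (1 - v) powr \<alpha>) * (indicator {0..1} v *\<^sub>R g (t * v)))"
  proof (rule Bochner_Integration.integrable_bound)
    show "integrable lborel (\<lambda>v. B * (indicator {0..1} v / (1 - v) powr \<alpha>))"
      using integrable_beta_kernel[OF \<open>\<alpha> < 1\<close>] by (simp del: times_divide_eq_right times_divide_eq_left)
    show "AE v in lborel. norm ((indicator {0..1} v / (1 - v) powr \<alpha>) * (indicator {0..1} v *\<^sub>R g (t * v)))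
        \<le> norm (B * (indicator {0..1} v / (1 - v) powr \<alpha>))"
    proof (intro always_eventually allI)
      fix v :: real
      have "\<bar>g (t * v)\<bar> \<le> \<bar>B\<bar>" if "v \<in> {0..1}"
        using B[of "t * v"] that \<open>t \<ge> 0\<close> mult_left_le[of v t] by auto
      then show "norm ((indicator {0..1} v / (1 - v) powr \<alpha>) * (indicator {0..1} v *\<^sub>R g (t * v)))
        \<le> norm (B * (indicator {0..1} v / (1 - v) powr \<alpha>))"
        by (auto simp: indicator_def abs_mult divide_right_mono)
    qed
  qed (use m in measurable)
  then show ?thesis
    by (rule Bochner_Integration.integrable_cong[THEN iffD1, rotated 2]) (auto simp: indicator_def)
qed

lemma caputo_integral_diff:
  fixes g h :: "real \<Rightarrow> real"
  assumes "continuous_on {0..} g" "continuous_on {0..} h" "t \<ge> 0" "\<alpha> < 1"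
  shows "caputo_integral \<alpha> (\<lambda>u. g u - h u) t = caputo_integral \<alpha> g t - caputo_integral \<alpha> h t"
  using integrable_caputo_scaled[OF assms(1,3,4)] integrable_caputo_scaled[OF assms(2,3,4)]
  by (simp add: caputo_integral_scaled[OF assms(3,4)] right_diff_distrib)

text \<open>
  The times and the integrands vary together: varying times give continuity of \<open>caputo_integral \<alpha> g\<close>,
  varying integrands allow cutoffs to be removed.
\<close>
lemma caputo_integral_tendsto:
  fixes g :: "nat \<Rightarrow> real \<Rightarrow> real"
  assumes \<alpha>: "\<alpha> < 1" and g: "\<And>n. continuous_on {0..} (g n)" "continuous_on {0..} g0"
    and t: "\<And>n. x n \<ge> 0" "t \<ge> 0" "x \<longlonglongrightarrow> t"
    and lim: "\<And>v. 0 \<le> v \<Longrightarrow> v \<le> 1 \<Longrightarrow> (\<lambda>n. g n (x n * v)) \<longlonglongrightarrow> g0 (t * v)"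
    and B: "\<And>n v. 0 \<le> v \<Longrightarrow> v \<le> 1 \<Longrightarrow> \<bar>g n (x n * v)\<bar> \<le> B"
  shows "(\<lambda>n. caputo_integral \<alpha> (g n) (x n)) \<longlonglongrightarrow> caputo_integral \<alpha> g0 t"
proof -
  let ?k = "\<lambda>v::real. indicator {0..1} v / (1 - v) powr \<alpha>"
  have "(\<lambda>n. LINT v|lborel. ?k v * g n (x n * v)) \<longlonglongrightarrow> (LINT v|lborel. ?k v * g0 (t * v))"
  proof (rule integral_dominated_convergence)
    show "integrable lborel (\<lambda>v. B * ?k v)"
      using integrable_beta_kernel[OF \<alpha>] by (simp del: times_divide_eq_right times_divide_eq_left)
    show "(\<lambda>v. ?k v * g0 (t * v)) \<in> borel_measurable lborel"
      using integrable_caputo_scaled[OF g(2) t(2) \<alpha>] by auto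
    show "(\<lambda>v. ?k v * g n (x n * v)) \<in> borel_measurable lborel" for n
      using integrable_caputo_scaled[OF g(1) t(1) \<alpha>] by auto
    show "AE v in lborel. (\<lambda>n. ?k v * g n (x n * v)) \<longlonglongrightarrow> ?k v * g0 (t * v)"
    proof (intro always_eventually allI)
      fix v :: real
      show "(\<lambda>n. ?k v * g n (x n * v)) \<longlonglongrightarrow> ?k v * g0 (t * v)"
        by (cases "v \<in> {0..1}") (auto intro!: tendsto_mult tendsto_const lim simp del: times_divide_eq_left)
    qed
    show "AE v in lborel. norm (?k v * g n (x n * v)) \<le> B * ?k v" for n
    proof (intro always_eventually allI)
      fix v :: real
      show "norm (?k v * g n (x n * v)) \<le> B * ?k v"
        using B[of v n] by (cases "v \<in> {0..1}") (auto simp: abs_mult intro!: divide_right_mono)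
    qed
  qed
  then show ?thesis
    unfolding caputo_integral_scaled[OF t(1) \<alpha>] caputo_integral_scaled[OF t(2) \<alpha>]
    using t \<alpha> by (intro tendsto_mult tendsto_powr2[OF _ tendsto_const]) (auto intro!: always_eventually)
qed

lemma continuous_on_caputo_integral:
  fixes g :: "real \<Rightarrow> real"
  assumes g: "continuous_on {0..} g" and \<alpha>: "\<alpha> < 1"
  shows "continuous_on {0..} (caputo_integral \<alpha> g)"
proof (rule continuous_on_sequentiallyI)
  fix x and t :: real
  assume x: "\<forall>n. x n \<in> {0..}" "t \<in> {0..}" "x \<longlonglongrightarrow> t"
  have "bounded (range x)"
    using x(3) by (rule convergent_imp_bounded)
  then obtain M where M: "\<And>n. x n \<le> M"
    by (auto simp: bounded_iff abs_le_iff)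
  have "bounded (g ` {0..M})"
    by (intro compact_imp_bounded compact_continuous_image continuous_on_subset[OF g]) auto
  then obtain B where B: "\<And>x. x \<in> {0..M} \<Longrightarrow> \<bar>g x\<bar> \<le> B"
    by (fastforce simp: bounded_iff)
  show "(\<lambda>n. caputo_integral \<alpha> g (x n)) \<longlonglongrightarrow> caputo_integral \<alpha> g t"
  proof (rule caputo_integral_tendsto[OF \<alpha> g g _ _ x(3)])
    fix v :: real assume v: "0 \<le> v" "v \<le> 1"
    show "(\<lambda>n. g (x n * v)) \<longlonglongrightarrow> g (t * v)"
      by (rule continuous_on_tendsto_compose[OF g]) (use x v in \<open>auto intro!: tendsto_intros\<close>)
    show "\<bar>g (x n * v)\<bar> \<le> B" for n
      using B[of "x n * v"] v x(1)[rule_format, of n] M[of n] mult_left_le[of v "x n"] by auto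
  qed (use x in auto)
qed

lemma integral_exp_Ici:
  fixes s :: real
  assumes "s > 0"
  shows "integrable lborel (\<lambda>t. indicator {0..} t * exp (- s * t))"
    and "(LINT t|lborel. indicator {0..} t * exp (- s * t)) = 1 / s"
proof -
  have "has_bochner_integral lborel (\<lambda>t. indicator {0..} t * (exp (- s * t) / t powr 0)) (1 / s)"
    using gamma_integral_scaled[of 0 s] assms by (simp add: powr_minus_divide)
  moreover have "AE t in lborel. indicator {0..} t * (exp (- s * t) / t powr 0) = indicator {0..} t * exp (- s * t)"
    using AE_lborel_singleton[of "0::real"] by (auto elim!: eventually_mono)
  ultimately have "has_bochner_integral lborel (\<lambda>t. indicator {0..} t * exp (- s * t)) (1 / s)"
    by (subst (asm) has_bochner_integral_cong_AE) auto
  then show "integrable lborel (\<lambda>t. indicator {0..} t * exp (- s * t))"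
    and "(LINT t|lborel. indicator {0..} t * exp (- s * t)) = 1 / s"
    by (auto simp: has_bochner_integral_iff)
qed

lemma laplace_integrable_bounded:
  fixes g :: "real \<Rightarrow> 'a::{banach, second_countable_topology}"
  assumes "continuous_on {0..} g" "\<And>t. t \<ge> 0 \<Longrightarrow> norm (g t) \<le> B" "s > 0"
  shows "laplace_integrable g s"
proof -
  have [measurable]: "(\<lambda>t. indicator {0..} t *\<^sub>R g t) \<in> borel_measurable borel"
    by (rule borel_measurable_continuous_on_indicator[OF _ assms(1)]) simp
  have "integrable lborel (\<lambda>t. (indicator {0..} t * exp (- s * t)) *\<^sub>R (indicator {0..} t *\<^sub>R g t))"
  proof (rule Bochner_Integration.integrable_bound)
    show "integrable lborel (\<lambda>t. B * (indicator {0..} t * exp (- s * t)))"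
      using integral_exp_Ici[OF assms(3)] by auto
    show "AE t in lborel. norm ((indicator {0..} t * exp (- s * t)) *\<^sub>R (indicator {0..} t *\<^sub>R g t))
      \<le> norm (B * (indicator {0..} t * exp (- s * t)))"
      using assms(2) by (intro always_eventually allI) (force simp: indicator_def abs_mult)
  qed measurable
  then show ?thesis
    unfolding laplace_integrable_def set_integrable_def
    by (rule Bochner_Integration.integrable_cong[THEN iffD1, rotated 2]) (auto simp: indicator_def)
qed

lemma laplace_const:
  assumes "s > 0"
  shows "laplace (\<lambda>_. c::real) s = c / s"
  using integral_exp_Ici[OF assms]
  by (simp add: laplace_def set_lebesgue_integral_def flip: mult.assoc)

section \<open>Uniqueness of Laplace transforms\<close>

text \<open>
  The Laplace transform at the integers gives the moments of \<open>\<psi>\<close> in the variable \<open>exp (- t)\<close>; by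
  Weierstrass approximation, vanishing moments annihilate every continuous function of it.
\<close>
lemma integral_eq_zero_of_laplace_zero:
  fixes \<psi> :: "real \<Rightarrow> real"
  assumes \<psi>: "integrable lborel \<psi>" and nn: "\<And>t. t < 0 \<Longrightarrow> \<psi> t = 0"
    and zero: "\<And>n::nat. (LINT t|lborel. exp (- t) ^ n * \<psi> t) = 0"
    and c: "continuous_on {0..1} c"
  shows "(LINT t|lborel. indicator {0..} t * c (exp (- t)) * \<psi> t) = 0"
proof -
  let ?I = "LINT t|lborel. indicator {0..} t * c (exp (- t)) * \<psi> t"
  have [measurable]: "\<psi> \<in> borel_measurable borel" using \<psi> by auto
  have "continuous_on {0..} (\<lambda>t::real. c (exp (- t)))"
    by (intro continuous_on_compose2[OF c] continuous_intros) auto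
  then have [measurable]: "(\<lambda>t::real. indicator {0..} t * c (exp (- t))) \<in> borel_measurable borel"
    using borel_measurable_continuous_on_indicator[of "{0::real..}" "\<lambda>t. c (exp (- t))"] by simp
  have bound: "\<bar>?I\<bar> \<le> e * (LINT t|lborel. \<bar>\<psi> t\<bar>)" if "e > 0" for e
  proof -
    obtain p where p: "real_polynomial_function p" "\<And>x. x \<in> {0..1} \<Longrightarrow> \<bar>c x - p x\<bar> < e"
      using Stone_Weierstrass_real_polynomial_function[OF compact_Icc c \<open>e > 0\<close>] by blast
    then obtain a N where a: "p = (\<lambda>x. \<Sum>i\<le>N. a i * x ^ i)"
      by (auto simp: real_polynomial_function_iff_sum)
    have pint: "integrable lborel (\<lambda>t. exp (- t) ^ n * \<psi> t)" for n
    proof (rule Bochner_Integration.integrable_bound[OF \<psi>])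
      show "AE t in lborel. norm (exp (- t) ^ n * \<psi> t) \<le> norm (\<psi> t)"
      proof (intro always_eventually allI)
        fix t show "norm (exp (- t) ^ n * \<psi> t) \<le> norm (\<psi> t)"
          by (cases "t < 0") (auto simp: nn abs_mult intro!: mult_left_le_one_le power_le_one)
      qed
    qed measurable
    have sum: "p (exp (- t)) * \<psi> t = (\<Sum>i\<le>N. a i * (exp (- t) ^ i * \<psi> t))" for t
      by (simp add: a sum_distrib_right mult.assoc)
    have pz: "(LINT t|lborel. p (exp (- t)) * \<psi> t) = 0" and pI: "integrable lborel (\<lambda>t. p (exp (- t)) * \<psi> t)"
      unfolding sum using pint by (simp_all add: zero)
    have diff: "norm (indicator {0..} t * c (exp (- t)) * \<psi> t - p (exp (- t)) * \<psi> t) \<le> e * \<bar>\<psi> t\<bar>" for t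
    proof (cases "t < 0")
      case False
      then have "\<bar>c (exp (- t)) - p (exp (- t))\<bar> \<le> e" using p(2)[of "exp (- t)"] by simp
      then show ?thesis using False by (auto simp: abs_mult mult_right_mono simp flip: left_diff_distrib)
    qed (simp add: nn)
    have dI: "integrable lborel (\<lambda>t. indicator {0..} t * c (exp (- t)) * \<psi> t - p (exp (- t)) * \<psi> t)"
    proof (rule Bochner_Integration.integrable_bound)
      show "integrable lborel (\<lambda>t. e * \<bar>\<psi> t\<bar>)" using \<psi> by simp
      show "AE t in lborel. norm (indicator {0..} t * c (exp (- t)) * \<psi> t - p (exp (- t)) * \<psi> t) \<le> norm (e * \<bar>\<psi> t\<bar>)"
        using diff \<open>e > 0\<close> by (auto simp: abs_mult)
      show "(\<lambda>t. indicator {0..} t * c (exp (- t)) * \<psi> t - p (exp (- t)) * \<psi> t) \<in> borel_measurable lborel"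
        using pI by (intro borel_measurable_diff borel_measurable_integrable[OF pI]) measurable
    qed
    have "?I = (LINT t|lborel. (indicator {0..} t * c (exp (- t)) * \<psi> t - p (exp (- t)) * \<psi> t) + p (exp (- t)) * \<psi> t)"
      by simp
    also have "\<dots> = (LINT t|lborel. indicator {0..} t * c (exp (- t)) * \<psi> t - p (exp (- t)) * \<psi> t)"
      by (subst Bochner_Integration.integral_add[OF dI pI]) (simp add: pz)
    finally have "?I = \<dots>" .
    also have "\<bar>\<dots>\<bar> \<le> (LINT t|lborel. e * \<bar>\<psi> t\<bar>)"
      using Bochner_Integration.integral_norm_bound_integral[OF dI, of "\<lambda>t. e * \<bar>\<psi> t\<bar>"] diff \<psi> by auto
    finally show ?thesis by simp
  qed
  have "\<bar>?I\<bar> \<le> 0 + e" if "e > 0" for e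
  proof -
    let ?J = "LINT t|lborel. \<bar>\<psi> t\<bar>"
    have J: "?J \<ge> 0" by simp
    then have J1: "?J + 1 > 0" by linarith
    have "\<bar>?I\<bar> \<le> e / (?J + 1) * ?J" using J that by (intro bound divide_pos_pos add_nonneg_pos) auto
    also have "\<dots> \<le> e" using J1 that by (simp add: pos_divide_le_eq del: Bochner_Integration.integral_add)
    finally show ?thesis by simp
  qed
  then have "\<bar>?I\<bar> \<le> 0" by (rule field_le_epsilon)
  then show ?thesis by simp
qed

text \<open>
  Continuous functions of \<open>exp (- t)\<close> approximate the indicator of \<open>{0..<T}\<close>, so the primitive of
  \<open>exp (- t) f t\<close> vanishes identically, and so does its derivative.
\<close>
lemma laplace_unique_zero:
  fixes f :: "real \<Rightarrow> real"
  assumes f: "continuous_on {0..} f" and int: "laplace_integrable f 1"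
    and zero: "\<And>s. s \<ge> 1 \<Longrightarrow> laplace f s = 0" and "t \<ge> 0"
  shows "f t = 0"
proof -
  define \<psi> where "\<psi> t = indicator {0..} t * (exp (- t) * f t)" for t
  have \<psi>: "integrable lborel \<psi>"
    using int by (simp add: laplace_integrable_def set_integrable_def \<psi>_def[abs_def])
  then have [measurable]: "\<psi> \<in> borel_measurable borel" by auto
  have z: "(LINT t|lborel. exp (- t) ^ n * \<psi> t) = 0" for n :: nat
  proof -
    have "exp (- t) ^ n * \<psi> t = indicator {0..} t *\<^sub>R (exp (- (real n + 1) * t) *\<^sub>R f t)" for t
      by (simp add: \<psi>_def exp_of_nat_mult[symmetric] exp_add[symmetric] algebra_simps mult_exp_exp)
    then show ?thesis
      using zero[of "real n + 1"] by (simp add: laplace_def set_lebesgue_integral_def)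
  qed
  \<comment> \<open>ramp functions of \<open>exp (- t)\<close> that increase to the indicator of \<open>t < T\<close>\<close>
  have prim: "(LINT t|lborel. indicator {0..<T} t * \<psi> t) = 0" for T
  proof -
    define c where "c n x = min 1 (max 0 (real n * (x - exp (- T))))" for n :: nat and x :: real
    have "(\<lambda>n. LINT t|lborel. indicator {0..} t * c n (exp (- t)) * \<psi> t) \<longlonglongrightarrow> (LINT t|lborel. indicator {0..<T} t * \<psi> t)"
    proof (rule integral_dominated_convergence)
      show "integrable lborel (\<lambda>t. \<bar>\<psi> t\<bar>)" using \<psi> by simp
      show "AE t in lborel. (\<lambda>n. indicator {0..} t * c n (exp (- t)) * \<psi> t) \<longlonglongrightarrow> indicator {0..<T} t * \<psi> t"
      proof (intro always_eventually allI)
        fix t :: real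
        have "(\<lambda>n. c n (exp (- t))) \<longlonglongrightarrow> indicator {..<T} t"
        proof (cases "t < T")
          case True
          then have "filterlim (\<lambda>n. real n * (exp (- t) - exp (- T))) at_top sequentially"
            by (intro filterlim_at_top_mult_tendsto_pos[OF tendsto_const] filterlim_real_sequentially) auto
          then have "\<forall>\<^sub>F n in sequentially. real n * (exp (- t) - exp (- T)) \<ge> 1"
            by (simp add: filterlim_at_top)
          then have "\<forall>\<^sub>F n in sequentially. c n (exp (- t)) = 1"
            by eventually_elim (simp add: c_def)
          then show ?thesis using True by (simp add: tendsto_eventually)
        next
          case False
          then have "c n (exp (- t)) = 0" for n
            by (simp add: c_def mult_nonneg_nonpos)
          then show ?thesis using False by simp
        qed
        from tendsto_mult[OF tendsto_mult[OF tendsto_const[of "indicator {0..} t"] this] tendsto_const[of "\<psi> t"]]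
        show "(\<lambda>n. indicator {0..} t * c n (exp (- t)) * \<psi> t) \<longlonglongrightarrow> indicator {0..<T} t * \<psi> t"
          by (simp add: indicator_def of_bool_conj split: if_splits)
      qed
      show "AE t in lborel. norm (indicator {0..} t * c n (exp (- t)) * \<psi> t) \<le> \<bar>\<psi> t\<bar>" for n
        by (intro always_eventually allI) (auto simp: c_def abs_mult indicator_def mult_left_le_one_le)
    qed (simp_all add: c_def)
    moreover have "(LINT t|lborel. indicator {0..} t * c n (exp (- t)) * \<psi> t) = 0" for n
      by (rule integral_eq_zero_of_laplace_zero[OF \<psi> _ z])
        (auto simp: \<psi>_def c_def intro!: continuous_intros)
    ultimately show ?thesis by (simp add: LIMSEQ_const_iff)
  qed
  have prim': "integral {0..T} (\<lambda>t. exp (- t) * f t) = 0" for T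
  proof -
    have "set_integrable lborel {0..T} (\<lambda>t. exp (- t) * f t)"
      by (intro borel_integrable_atLeastAtMost' continuous_intros continuous_on_subset[OF f]) auto
    then have "integral {0..T} (\<lambda>t. exp (- t) * f t) = (LINT t:{0..T}|lborel. exp (- t) * f t)"
      by (rule set_borel_integral_eq_integral(2)[symmetric])
    also have "\<dots> = (LINT t|lborel. indicator {0..<T} t * \<psi> t)"
      unfolding set_lebesgue_integral_def
    proof (rule integral_cong_AE)
      have "(\<lambda>t. indicator {0..T} t * \<psi> t) \<in> borel_measurable lborel" by simp
      also have "(\<lambda>t. indicator {0..T} t * \<psi> t) = (\<lambda>t. indicator {0..T} t *\<^sub>R (exp (- t) * f t))"
        by (auto simp: \<psi>_def indicator_def)
      finally show "(\<lambda>t. indicator {0..T} t *\<^sub>R (exp (- t) * f t)) \<in> borel_measurable lborel" .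
      show "AE t in lborel. indicator {0..T} t *\<^sub>R (exp (- t) * f t) = indicator {0..<T} t * \<psi> t"
        using AE_lborel_singleton[of T] by eventually_elim (auto simp: \<psi>_def indicator_def)
    qed simp
    finally show ?thesis using prim by simp
  qed
  have "((\<lambda>T. integral {0..T} (\<lambda>t. exp (- t) * f t)) has_vector_derivative exp (- t) * f t) (at t within {0..t + 1})"
    using \<open>t \<ge> 0\<close> by (intro integral_has_vector_derivative continuous_intros continuous_on_subset[OF f]) auto
  then have "((\<lambda>T. 0 :: real) has_vector_derivative exp (- t) * f t) (at t within {0..t + 1})"
    by (simp add: prim')
  then have "exp (- t) * f t = 0"
    using has_vector_derivative_const \<open>t \<ge> 0\<close>
    by (intro vector_derivative_unique_within[of t "{0..t+1}" "\<lambda>_. 0 :: real"])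
      (auto simp: trivial_limit_within)
  then show ?thesis by simp
qed

lemma laplace_diff:
  fixes f g :: "real \<Rightarrow> real"
  assumes "laplace_integrable f s" "laplace_integrable g s"
  shows "laplace_integrable (\<lambda>t. f t - g t) s" "laplace (\<lambda>t. f t - g t) s = laplace f s - laplace g s"
  using assms unfolding laplace_integrable_def laplace_def scaleR_diff_right
  by simp_all

lemma laplace_cmult:
  fixes f :: "real \<Rightarrow> real"
  assumes "laplace_integrable f s"
  shows "laplace_integrable (\<lambda>t. c * f t) s" "laplace (\<lambda>t. c * f t) s = c * laplace f s"
  using assms unfolding laplace_integrable_def laplace_def set_integrable_def set_lebesgue_integral_def
  by (simp_all add: mult.left_commute[of _ c])

lemma laplace_unique:
  fixes f g :: "real \<Rightarrow> real"
  assumes "continuous_on {0..} f" "continuous_on {0..} g"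
    and "\<And>s. s > 0 \<Longrightarrow> laplace_integrable f s" "\<And>s. s > 0 \<Longrightarrow> laplace_integrable g s"
    and "\<And>s. s > 0 \<Longrightarrow> laplace f s = laplace g s" and "t \<ge> 0"
  shows "f t = g t"
  using laplace_unique_zero[of "\<lambda>t. f t - g t" t] laplace_diff[of f _ g] assms
  by (auto intro: continuous_intros)

section \<open>The Caputo equation in integrated and in transformed form\<close>

lemma caputo_integral_0:
  fixes h :: "real \<Rightarrow> real"
  assumes "continuous_on {0..} h" "t \<ge> 0"
  shows "caputo_integral 0 h t = integral {0..t} h"
proof -
  have "set_integrable lborel {0..t} h"
    by (intro borel_integrable_atLeastAtMost' continuous_on_subset[OF assms(1)]) auto
  then have int: "integrable lborel (\<lambda>u. indicator {0..t} u *\<^sub>R h u)" 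
     and eq: "integral {0..t} h = (LINT u|lborel. indicator {0..t} u *\<^sub>R h u)"
    by (auto simp: set_integrable_def set_borel_integral_eq_integral(2)[symmetric] set_lebesgue_integral_def)
  from int have [measurable]: "(\<lambda>u. indicator {0..t} u *\<^sub>R h u) \<in> borel_measurable borel"
    by auto
  have "(LINT u|lborel. (indicator {0..t} u *\<^sub>R h u) / (t - u) powr 0) = (LINT u|lborel. indicator {0..t} u *\<^sub>R h u)"
  proof (rule integral_cong_AE)
    show "AE u in lborel. (indicator {0..t} u *\<^sub>R h u) / (t - u) powr 0 = indicator {0..t} u *\<^sub>R h u"
      using AE_lborel_singleton[of t] by (auto elim!: eventually_mono)
  qed measurable
  then show ?thesis
    by (simp add: caputo_integral_def set_lebesgue_integral_def eq)
qed

lemma caputo_integral_0_deriv: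
  fixes h :: "real \<Rightarrow> real"
  assumes h: "continuous_on {0..} h" and "t > 0"
  shows "(caputo_integral 0 h has_real_derivative h t) (at t)"
proof -
  have "((\<lambda>x. integral {0..x} h) has_real_derivative h t) (at t within {0..t+1})"
    using \<open>t > 0\<close> unfolding has_real_derivative_iff_has_vector_derivative
    by (intro integral_has_vector_derivative continuous_on_subset[OF h]) auto
  then have "((\<lambda>x. integral {0..x} h) has_real_derivative h t) (at t)"
    using \<open>t > 0\<close> by (subst (asm) at_within_interior) auto
  then show ?thesis
    by (rule has_field_derivative_transform_within_open[of _ _ _ "{0<..}"])
      (use \<open>t > 0\<close> in \<open>auto simp: caputo_integral_0[OF h]\<close>)
qed

text \<open>
  The integrated form avoids differentiability altogether.  Passing to it loses nothing because
  \<open>caputo_integral \<beta> g\<close> is continuous and vanishes at \<open>0\<close>, which fixes the constant of integration.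
\<close>
lemma caputo_iff_integrated:
  fixes g h :: "real \<Rightarrow> real"
  assumes \<beta>: "0 < \<beta>" "\<beta> < 1" and g: "continuous_on {0..} g" and h: "continuous_on {0..} h"
  shows "(\<forall>t>0. caputo_differentiable \<beta> g t \<and> caputo_deriv \<beta> g t = h t) \<longleftrightarrow>
         (\<forall>t\<ge>0. caputo_integral \<beta> (\<lambda>u. g u - g 0) t = Gamma (1 - \<beta>) * caputo_integral 0 h t)"
    (is "?L \<longleftrightarrow> ?R")
proof -
  have G: "Gamma (1 - \<beta>) > 0" using \<beta> by (simp add: Gamma_real_pos)
  define D where "D t = caputo_integral \<beta> (\<lambda>u. g u - g 0) t" for t
  have D: "D t = caputo_integral \<beta> g t - g 0 * t powr (1 - \<beta>) / (1 - \<beta>)" if "t \<ge> 0" for t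
    using caputo_integral_diff[OF g continuous_on_const that \<beta>(2)] \<beta> that
    by (simp add: D_def caputo_integral_const)
  have pw: "((\<lambda>t. g 0 * t powr (1 - \<beta>) / (1 - \<beta>)) has_real_derivative g 0 * t powr (- \<beta>)) (at t)" if "t > 0" for t
    using that \<beta> by (auto intro!: derivative_eq_intros)
  show ?thesis
  proof
    assume L: ?L
    have dD: "(D has_real_derivative Gamma (1 - \<beta>) * h t) (at t)" if t: "t > 0" for t
    proof -
      have "(caputo_integral \<beta> g has_real_derivative deriv (caputo_integral \<beta> g) t) (at t)"
        using L t by (auto simp: caputo_differentiable_def DERIV_deriv_iff_real_differentiable)
      moreover have "deriv (caputo_integral \<beta> g) t = Gamma (1 - \<beta>) * h t + g 0 * t powr (- \<beta>)"
        using L[rule_format, OF t] G by (auto simp: caputo_deriv_def field_simps)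
      ultimately have "((\<lambda>t. caputo_integral \<beta> g t - g 0 * t powr (1 - \<beta>) / (1 - \<beta>)) has_real_derivative Gamma (1 - \<beta>) * h t) (at t)"
        using DERIV_diff[OF _ pw[OF t]] by fastforce
      then show ?thesis
        by (rule has_field_derivative_transform_within_open[of _ _ _ "{0<..}"]) (use t D in auto)
    qed
    define F where "F t = D t - Gamma (1 - \<beta>) * caputo_integral 0 h t" for t
    have z: "D 0 = 0" "caputo_integral 0 h 0 = 0"
      using \<beta> by (simp_all add: D_def caputo_integral_scaled)
    have "F t = 0" if "t \<ge> 0" for t
    proof (cases "t = 0")
      case False
      have "F t = F 0"
      proof (rule DERIV_isconst_end[of 0 t F])
        show "0 < t" using that False by simp
        show "continuous_on {0..t} F"
          unfolding F_def D_def using \<beta>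
          by (intro continuous_intros continuous_on_subset[OF continuous_on_caputo_integral] g h) auto
        show "(F has_real_derivative 0) (at x)" if "0 < x" "x < t" for x
          unfolding F_def[abs_def] using DERIV_diff[OF dD[OF that(1)] DERIV_cmult[OF caputo_integral_0_deriv[OF h that(1)], of "Gamma (1 - \<beta>)"]]
          by simp
      qed
      then show ?thesis using z by (simp add: F_def)
    qed (use z in \<open>simp add: F_def\<close>)
    then show ?R by (simp add: D_def F_def)
  next
    assume R: ?R
    show ?L
    proof (intro allI impI)
      fix t :: real assume t: "t > 0"
      have "((\<lambda>t. Gamma (1 - \<beta>) * caputo_integral 0 h t + g 0 * t powr (1 - \<beta>) / (1 - \<beta>)) has_real_derivative
          Gamma (1 - \<beta>) * h t + g 0 * t powr (- \<beta>)) (at t)"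
        by (intro DERIV_add DERIV_cmult caputo_integral_0_deriv pw h t)
      then have d: "(caputo_integral \<beta> g has_real_derivative Gamma (1 - \<beta>) * h t + g 0 * t powr (- \<beta>)) (at t)"
        by (rule has_field_derivative_transform_within_open[of _ _ _ "{0<..}"]) 
          (use t D R in \<open>auto simp: D_def algebra_simps\<close>)
      then show "caputo_differentiable \<beta> g t \<and> caputo_deriv \<beta> g t = h t"
        using DERIV_imp_deriv[OF d] G
        by (auto simp: caputo_differentiable_def caputo_deriv_def real_differentiable_def field_simps)
    qed
  qed
qed

text \<open>
  In terms of transforms the integrated equation reads
  \<open>\<Gamma>(1 - \<beta>) s powr (\<beta> - 1) (laplace g s - g0 / s) = \<Gamma>(1 - \<beta>) laplace h s / s\<close>; continuity of both
  sides turns equality of transforms back into pointwise equality.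
\<close>
lemma integrated_iff_laplace:
  fixes g h :: "real \<Rightarrow> real"
  assumes \<beta>: "0 < \<beta>" "\<beta> < 1" and g: "continuous_on {0..} g" and h: "continuous_on {0..} h"
    and ig: "\<And>s. s > 0 \<Longrightarrow> laplace_integrable g s" and ih: "\<And>s. s > 0 \<Longrightarrow> laplace_integrable h s"
  shows "(\<forall>t\<ge>0. caputo_integral \<beta> (\<lambda>u. g u - g0) t = Gamma (1 - \<beta>) * caputo_integral 0 h t) \<longleftrightarrow>
         (\<forall>s>0. s powr \<beta> * laplace g s - s powr (\<beta> - 1) * g0 = laplace h s)" (is "?L \<longleftrightarrow> ?R")
proof -
  have G: "Gamma (1 - \<beta>) > 0" using \<beta> by (simp add: Gamma_real_pos)
  let ?A = "caputo_integral \<beta> (\<lambda>u. g u - g0)" and ?B = "\<lambda>t. Gamma (1 - \<beta>) * caputo_integral 0 h t"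
  have ic: "laplace_integrable (\<lambda>_. g0) s" if "s > 0" for s
    using that by (intro laplace_integrable_bounded[of _ "\<bar>g0\<bar>"]) auto
  have iA: "laplace_integrable ?A s" and lA: "laplace ?A s = Gamma (1 - \<beta>) * s powr (\<beta> - 1) * (laplace g s - g0 / s)" if "s > 0" for s
    using laplace_diff[OF ig[OF that] ic[OF that]] laplace_caputo_integral[of "\<lambda>u. g u - g0" s \<beta>] \<beta> that
    by (auto simp: laplace_const)
  have iB: "laplace_integrable ?B s" and lB: "laplace ?B s = Gamma (1 - \<beta>) * (laplace h s / s)" if "s > 0" for s
    using laplace_caputo_integral[OF ih[OF that], of 0] that
      laplace_cmult[of "caputo_integral 0 h" s "Gamma (1 - \<beta>)"]
    by (auto simp: powr_minus_divide)
  have eq: "laplace ?A s = laplace ?B s \<longleftrightarrow> s powr \<beta> * laplace g s - s powr (\<beta> - 1) * g0 = laplace h s" if "s > 0" for s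
  proof -
    have "laplace ?A s = laplace ?B s \<longleftrightarrow> s * s powr (\<beta> - 1) * (laplace g s - g0 / s) = laplace h s"
    proof -
      have "Gamma (1 - \<beta>) * p * X = Gamma (1 - \<beta>) * (H / s) \<longleftrightarrow> s * p * X = H" for p X H :: real
      proof -
        have "Gamma (1 - \<beta>) * p * X = Gamma (1 - \<beta>) * (H / s) \<longleftrightarrow> p * X = H / s"
          using G by (simp add: mult.assoc del: times_divide_eq_right)
        also have "\<dots> \<longleftrightarrow> s * p * X = H"
          using that by (auto simp: field_simps)
        finally show ?thesis .
      qed
      then show ?thesis unfolding lA[OF that] lB[OF that] .
    qed
    also have "s * s powr (\<beta> - 1) * (laplace g s - g0 / s) = s powr \<beta> * laplace g s - s powr (\<beta> - 1) * g0"
      using that by (simp add: powr_diff field_simps)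
    finally show ?thesis .
  qed
  show ?thesis
  proof
    assume L: ?L
    then have "laplace ?A s = laplace ?B s" for s
      unfolding laplace_def by (intro set_lebesgue_integral_cong) auto
    then show ?R using eq by blast
  next
    assume R: ?R
    show ?L
    proof (intro allI impI laplace_unique[of ?A ?B])
      show "continuous_on {0..} ?A" "continuous_on {0..} ?B"
        using \<beta> by (auto intro!: continuous_intros continuous_on_caputo_integral g h)
    qed (use iA iB eq R in auto)
  qed
qed

section \<open>Smooth cutoffs\<close>

text \<open>
  Peeling off the innermost derivative suits induction: the product rule then yields closure under
  products from closure under sums, without Leibniz' formula.
\<close>
primrec times_differentiable :: "nat \<Rightarrow> (real \<Rightarrow> real) \<Rightarrow> bool" where
  "times_differentiable 0 f \<longleftrightarrow> True"
| "times_differentiable (Suc n) f \<longleftrightarrow> (\<forall>x. f differentiable (at x)) \<and> times_differentiable n (deriv f)"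

lemma times_differentiable_iff:
  "times_differentiable n f \<longleftrightarrow> (\<forall>k<n. \<forall>x. (deriv ^^ k) f differentiable (at x))"
proof (induction n arbitrary: f)
  case (Suc n)
  have "(\<forall>k<Suc n. P k) \<longleftrightarrow> P 0 \<and> (\<forall>k<n. P (Suc k))" for P
    by (metis less_Suc_eq_0_disj)
  from this[of "\<lambda>k. \<forall>x. (deriv ^^ k) f differentiable (at x)"] show ?case
    by (simp add: Suc funpow_swap1 del: funpow.simps(2)) (simp add: funpow_swap1)
qed simp

lemma times_differentiable_SucI:
  assumes "\<And>x. (f has_real_derivative f' x) (at x)" "times_differentiable n f'"
  shows "times_differentiable (Suc n) f"
proof -
  have "deriv f = f'" using assms(1) by (intro ext DERIV_imp_deriv)
  then show ?thesis using assms by (auto simp: real_differentiable_def)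
qed

lemma times_differentiable_SucD:
  assumes "times_differentiable (Suc n) f"
  shows "(f has_real_derivative deriv f x) (at x)" "times_differentiable n (deriv f)"
    "times_differentiable n f"
proof -
  show "(f has_real_derivative deriv f x) (at x)" "times_differentiable n (deriv f)"
    using assms by (auto simp: DERIV_deriv_iff_real_differentiable)
  show "times_differentiable n f"
    using assms unfolding times_differentiable_iff by auto
qed

lemma times_differentiable_add:
  "times_differentiable n f \<Longrightarrow> times_differentiable n g \<Longrightarrow> times_differentiable n (\<lambda>x. f x + g x)"
proof (induction n arbitrary: f g)
  case (Suc n)
  show ?case
    by (rule times_differentiable_SucI[OF DERIV_add Suc.IH])
      (use Suc.prems times_differentiable_SucD in blast)+
qed simp

lemma times_differentiable_mult:
  "times_differentiable n f \<Longrightarrow> times_differentiable n g \<Longrightarrow> times_differentiable n (\<lambda>x. f x * g x)"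
proof (induction n arbitrary: f g)
  case (Suc n)
  show ?case
    by (rule times_differentiable_SucI[OF DERIV_mult times_differentiable_add[OF Suc.IH Suc.IH]])
      (use Suc.prems times_differentiable_SucD in blast)+
qed simp

text \<open>
  Stated for the linear span, which differentiation preserves; \<open>\<kappa> = 0\<close> covers the constants.
\<close>
lemma times_differentiable_trig:
  "times_differentiable n (\<lambda>x. a * cos (\<kappa> * x) + b * sin (\<kappa> * x))"
proof (induction n arbitrary: a b)
  case (Suc n)
  show ?case
    by (rule times_differentiable_SucI[OF _ Suc[of "b * \<kappa>" "- a * \<kappa>"]])
      (auto intro!: derivative_eq_intros simp: algebra_simps)
qed simp

lemma times_differentiable_const: "times_differentiable n (\<lambda>_. c)"
  using times_differentiable_trig[of n c 0 0] by simp

lemma times_differentiable_affine: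
  "times_differentiable n f \<Longrightarrow> times_differentiable n (\<lambda>x. f (a * x + b))"
proof (induction n arbitrary: f)
  case (Suc n)
  show ?case
  proof (rule times_differentiable_SucI)
    show "((\<lambda>x. f (a * x + b)) has_real_derivative deriv f (a * x + b) * a) (at x)" for x
      by (rule DERIV_chain2[OF times_differentiable_SucD(1)[OF Suc.prems]])
        (auto intro!: derivative_eq_intros)
    show "times_differentiable n (\<lambda>x. deriv f (a * x + b) * a)"
      by (rule times_differentiable_mult[OF Suc.IH[OF times_differentiable_SucD(2)[OF Suc.prems]] times_differentiable_const])
  qed
qed simp

text \<open>
  The derivative of a member of this family is a linear combination of two members, so smoothness
  at \<open>0\<close> is an induction that only needs the first derivative.
\<close>
definition flat_exp :: "nat \<Rightarrow> real \<Rightarrow> real" where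
  "flat_exp k x = (if x > 0 then exp (- inverse x) * inverse x ^ k else 0)"

lemma flat_exp_tendsto_0: "(flat_exp k \<longlongrightarrow> 0) (at_right 0)"
proof -
  have "((\<lambda>x::real. inverse x ^ k / exp (inverse x)) \<longlongrightarrow> 0) (at_right 0)"
    by (rule filterlim_compose[OF tendsto_power_div_exp_0 filterlim_inverse_at_top_right])
  moreover have "\<forall>\<^sub>F x in at_right 0. inverse x ^ k / exp (inverse x) = flat_exp k x"
    by (intro eventually_at_rightI[of 0 1]) (auto simp: flat_exp_def exp_minus divide_inverse mult.commute)
  ultimately show ?thesis
    by (rule Lim_transform_eventually)
qed

lemma DERIV_flat_exp: "(flat_exp k has_real_derivative flat_exp (k + 2) x - real k * flat_exp (k + 1) x) (at x)"
proof -
  consider "x > 0" | "x < 0" | "x = 0" by linarith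
  then show ?thesis
  proof cases
    case 1
    have i: "(inverse has_real_derivative - (inverse x ^ 2)) (at x)"
      using DERIV_inverse[of x UNIV] 1 by (simp add: numeral_2_eq_2)
    have e: "((\<lambda>x. exp (- inverse x)) has_real_derivative exp (- inverse x) * inverse x ^ 2) (at x)"
      using DERIV_chain2[OF DERIV_exp DERIV_minus[OF i]] by simp
    have p: "((\<lambda>x. inverse x ^ k) has_real_derivative - (real k * inverse x ^ (k + 1))) (at x)"
    proof (cases k)
      case (Suc m)
      have "((\<lambda>x. inverse x ^ k) has_real_derivative real k * (- (inverse x ^ 2) * inverse x ^ (k - Suc 0))) (at x)"
        by (rule DERIV_power[OF i])
      then show ?thesis
        by (simp add: Suc power2_eq_square mult_ac)
    qed simp
    have "((\<lambda>x. exp (- inverse x) * inverse x ^ k) has_real_derivative flat_exp (k + 2) x - real k * flat_exp (k + 1) x) (at x)"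
      using DERIV_mult[OF e p] 1 by (simp add: flat_exp_def power_add algebra_simps power2_eq_square)
    then show ?thesis
      by (rule has_field_derivative_transform_within_open[of _ _ _ "{0<..}"]) (use 1 in \<open>auto simp: flat_exp_def\<close>)
  next
    case 2
    have "((\<lambda>x. 0) has_real_derivative flat_exp (k + 2) x - real k * flat_exp (k + 1) x) (at x)"
      using 2 by (simp add: flat_exp_def)
    then show ?thesis
      by (rule has_field_derivative_transform_within_open[of _ _ _ "{..<0}"]) (use 2 in \<open>auto simp: flat_exp_def\<close>)
  next
    case 3
    have "((\<lambda>y. (flat_exp k y - flat_exp k 0) / (y - 0)) \<longlongrightarrow> 0) (at 0)"
    proof (rule filterlim_split_at)
      show "((\<lambda>y. (flat_exp k y - flat_exp k 0) / (y - 0)) \<longlongrightarrow> 0) (at_left 0)"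
        by (rule Lim_transform_eventually[OF tendsto_const])
          (auto simp: flat_exp_def intro!: eventually_at_leftI[of "-1"])
      show "((\<lambda>y. (flat_exp k y - flat_exp k 0) / (y - 0)) \<longlongrightarrow> 0) (at_right 0)"
        by (rule Lim_transform_eventually[OF flat_exp_tendsto_0[of "Suc k"]])
          (auto simp: flat_exp_def divide_inverse mult_ac intro!: eventually_at_rightI[of 0 1])
    qed
    then show ?thesis
      using 3 by (simp add: has_field_derivative_iff flat_exp_def)
  qed
qed

lemma times_differentiable_flat_exp: "times_differentiable n (flat_exp k)"
proof (induction n arbitrary: k)
  case (Suc n)
  show ?case
  proof (rule times_differentiable_SucI[OF DERIV_flat_exp])
    show "times_differentiable n (\<lambda>x. flat_exp (k + 2) x - real k * flat_exp (k + 1) x)"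
      using times_differentiable_add[OF Suc[of "k+2"] times_differentiable_mult[OF times_differentiable_const[of n "- real k"] Suc[of "k+1"]]]
      by simp
  qed
qed simp

text \<open>
  The factor normalises the value at \<open>0\<close> to \<open>1\<close>; the arguments are written in the form that
  \<open>times_differentiable_affine\<close> expects.
\<close>
definition bump :: "real \<Rightarrow> real" where
  "bump x = exp 2 * (flat_exp 0 (- 1 * x + 1) * flat_exp 0 (1 * x + 1))"

lemma bump_0: "bump 0 = 1"
  by (simp add: bump_def flat_exp_def flip: exp_add)

lemma bump_eq_0: "\<bar>x\<bar> \<ge> 1 \<Longrightarrow> bump x = 0"
  by (auto simp: bump_def flat_exp_def)

lemma times_differentiable_bump: "times_differentiable n bump"
  unfolding bump_def[abs_def]
  by (intro times_differentiable_mult times_differentiable_const times_differentiable_affine[OF times_differentiable_flat_exp])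

lemma test_function_iff:
  "test_function \<phi> \<longleftrightarrow> (\<forall>n. times_differentiable n \<phi>) \<and> (\<exists>N. \<forall>x. \<bar>x\<bar> \<ge> N \<longrightarrow> \<phi> x = 0)"
proof -
  have "(\<forall>n. times_differentiable n \<phi>) \<longleftrightarrow> (\<forall>n x. (deriv ^^ n) \<phi> differentiable (at x))"
    unfolding times_differentiable_iff by (meson lessI)
  moreover have "compact (closure {x. \<phi> x \<noteq> 0}) \<longleftrightarrow> (\<exists>N. \<forall>x. \<bar>x\<bar> \<ge> N \<longrightarrow> \<phi> x = 0)"
  proof -
    have "compact (closure {x. \<phi> x \<noteq> 0}) \<longleftrightarrow> bounded {x. \<phi> x \<noteq> 0}"
      by (rule compact_closure)
    also have "\<dots> \<longleftrightarrow> (\<exists>N. \<forall>x. \<bar>x\<bar> \<ge> N \<longrightarrow> \<phi> x = 0)"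
    proof
      assume "bounded {x. \<phi> x \<noteq> 0}"
      then obtain B where B: "\<forall>x\<in>{x. \<phi> x \<noteq> 0}. norm x \<le> B"
        unfolding bounded_iff by blast
      have "\<phi> x = 0" if "\<bar>x\<bar> \<ge> B + 1" for x
      proof (rule ccontr)
        assume "\<phi> x \<noteq> 0"
        then have "norm x \<le> B" using B by blast
        with that show False by simp
      qed
      then have "\<forall>x. \<bar>x\<bar> \<ge> B + 1 \<longrightarrow> \<phi> x = 0" by blast
      then show "\<exists>N. \<forall>x. \<bar>x\<bar> \<ge> N \<longrightarrow> \<phi> x = 0" ..
    next
      assume "\<exists>N. \<forall>x. \<bar>x\<bar> \<ge> N \<longrightarrow> \<phi> x = 0"
      then obtain N where "\<And>x. \<bar>x\<bar> \<ge> N \<Longrightarrow> \<phi> x = 0" by blast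
      then have "{x. \<phi> x \<noteq> 0} \<subseteq> {-N..N}" by (smt (verit) atLeastAtMost_iff mem_Collect_eq subsetI)
      then show "bounded {x. \<phi> x \<noteq> 0}" by (rule bounded_subset[OF bounded_closed_interval])
    qed
    finally show ?thesis .
  qed
  ultimately show ?thesis by (simp add: test_function_def)
qed

lemma test_functionD:
  assumes "test_function \<phi>"
  obtains N B B' where "N > 0" "\<And>x. \<bar>x\<bar> \<ge> N \<Longrightarrow> \<phi> x = 0" "\<And>x. \<bar>x\<bar> \<ge> N \<Longrightarrow> deriv \<phi> x = 0"
    "\<And>x. (\<phi> has_real_derivative deriv \<phi> x) (at x)"
    "continuous_on UNIV \<phi>" "continuous_on UNIV (deriv \<phi>)"
    "\<And>x. \<bar>\<phi> x\<bar> \<le> B" "\<And>x. \<bar>deriv \<phi> x\<bar> \<le> B'"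
proof -
  from assms obtain N0 where td: "\<And>n. times_differentiable n \<phi>" and N0: "\<And>x. \<bar>x\<bar> \<ge> N0 \<Longrightarrow> \<phi> x = 0"
    unfolding test_function_iff by blast
  define N where "N = \<bar>N0\<bar> + 1"
  have N: "N > 0" "\<And>x. \<bar>x\<bar> \<ge> N \<Longrightarrow> \<phi> x = 0" using N0 by (auto simp: N_def)
  have d: "(\<phi> has_real_derivative deriv \<phi> x) (at x)" 
    "(deriv \<phi> has_real_derivative deriv (deriv \<phi>) x) (at x)" for x
    using times_differentiable_SucD(1)[OF td[of "Suc 0"]] times_differentiable_SucD(1)[of 0 "deriv \<phi>"]
      times_differentiable_SucD(2)[of "Suc 0" \<phi>] td[of "Suc (Suc 0)"] by auto
  have c: "continuous_on UNIV \<phi>" "continuous_on UNIV (deriv \<phi>)"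
    using d by (meson DERIV_continuous_on has_field_derivative_at_within)+
  have z: "deriv \<phi> x = 0" if "\<bar>x\<bar> \<ge> N" for x
  proof -
    have "((\<lambda>_. 0) has_real_derivative 0) (at x)" by simp
    then have "(\<phi> has_real_derivative 0) (at x)"
      by (rule has_field_derivative_transform_within_open[of _ _ _ "- {- \<bar>N0\<bar>..\<bar>N0\<bar>}"])
        (use that N0 in \<open>auto simp: N_def\<close>)
    then show ?thesis by (rule DERIV_imp_deriv)
  qed
  have bd: "\<exists>B. \<forall>x. \<bar>f x\<bar> \<le> B" if "continuous_on UNIV f" "\<And>x. \<bar>x\<bar> \<ge> N \<Longrightarrow> f x = 0" for f :: "real \<Rightarrow> real"
  proof -
    have "bounded (f ` {-N..N})"
      by (intro compact_imp_bounded compact_continuous_image continuous_on_subset[OF that(1)]) auto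
    then obtain B where B: "\<And>x. x \<in> {-N..N} \<Longrightarrow> \<bar>f x\<bar> \<le> B" by (fastforce simp: bounded_iff)
    have "\<bar>f x\<bar> \<le> \<bar>B\<bar>" for x
      using B[of x] that(2)[of x] by (cases "\<bar>x\<bar> \<ge> N") force+
    then show ?thesis by blast
  qed
  obtain B where "\<forall>x. \<bar>\<phi> x\<bar> \<le> B" using bd[OF c(1) N(2)] by blast
  moreover obtain B' where "\<forall>x. \<bar>deriv \<phi> x\<bar> \<le> B'" using bd[OF c(2) z] by blast
  ultimately show ?thesis
    by (intro that[OF N(1,2) z d(1) c, of B B']) simp_all
qed

lemma test_function_bump: "test_function bump"
  unfolding test_function_iff using bump_eq_0 times_differentiable_bump by blast

text \<open>
  The cutoff \<open>bump (x / (n + 1))\<close> tends to \<open>bump 0 = 1\<close> everywhere, and its derivative carries a factor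
  \<open>1 / (n + 1)\<close>.
\<close>
lemma cutoff_sequence:
  assumes "\<And>n. times_differentiable n f"
    and f': "\<And>x. (f has_real_derivative f' x) (at x)"
    and B: "\<And>x. \<bar>f x\<bar> \<le> B" "\<And>x. \<bar>f' x\<bar> \<le> B"
  obtains \<phi> C where "\<And>n::nat. test_function (\<phi> n)" "\<And>n. \<phi> n 0 = f 0"
    "\<And>n x. \<bar>\<phi> n x\<bar> \<le> C" "\<And>n x. \<bar>deriv (\<phi> n) x\<bar> \<le> C"
    "\<And>x. (\<lambda>n. \<phi> n x) \<longlonglongrightarrow> f x" "\<And>x. (\<lambda>n. deriv (\<phi> n) x) \<longlonglongrightarrow> f' x"
proof -
  obtain A A' where bump': "\<And>x. (bump has_real_derivative deriv bump x) (at x)"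
    and cb: "continuous_on UNIV bump" 
    and A: "\<And>x. \<bar>bump x\<bar> \<le> A" "\<And>x. \<bar>deriv bump x\<bar> \<le> A'"
    by (rule test_functionD[OF test_function_bump]) blast
  have pos: "B \<ge> 0" "A \<ge> 0" "A' \<ge> 0"
    using B(1)[of 0] A(1)[of 0] A(2)[of 0] by linarith+
  define a where "a n = inverse (real (Suc n))" for n
  have a: "a n > 0" "a n \<le> 1" for n by (auto simp: a_def field_simps)
  have a0: "a \<longlonglongrightarrow> 0" unfolding a_def[abs_def] by (rule LIMSEQ_inverse_real_of_nat)
  define \<phi> where "\<phi> n x = f x * bump (a n * x + 0)" for n x
  have d: "(\<phi> n has_real_derivative f' x * bump (a n * x) + deriv bump (a n * x) * a n * f x) (at x)" for n x
  proof -
    have "((\<lambda>x. bump (a n * x)) has_real_derivative deriv bump (a n * x) * a n) (at x)"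
      by (rule DERIV_chain2[OF bump']) (auto intro!: derivative_eq_intros)
    from DERIV_mult[OF f' this] show ?thesis by (simp add: \<phi>_def[abs_def])
  qed
  have d': "deriv (\<phi> n) x = f' x * bump (a n * x) + deriv bump (a n * x) * a n * f x" for n x
    using d by (rule DERIV_imp_deriv)
  have lim_bump: "(\<lambda>n. bump (a n * x)) \<longlonglongrightarrow> 1" for x
  proof -
    have "(\<lambda>n. bump (a n * x)) \<longlonglongrightarrow> bump (0 * x)"
      by (rule continuous_on_tendsto_compose[OF cb]) (auto intro!: tendsto_mult_left_zero a0)
    then show ?thesis by (simp add: bump_0)
  qed
  show ?thesis
  proof (rule that[of \<phi> "B * A + A' * B"])
    fix n :: nat and x :: real
    show "test_function (\<phi> n)"
      unfolding test_function_iff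
    proof (intro conjI allI)
      show "times_differentiable m (\<phi> n)" for m
        unfolding \<phi>_def[abs_def]
        by (rule times_differentiable_mult[OF assms(1) times_differentiable_affine[OF times_differentiable_bump]])
      show "\<exists>N. \<forall>x. N \<le> \<bar>x\<bar> \<longrightarrow> \<phi> n x = 0"
        by (rule exI[of _ "real (Suc n)"]) 
          (auto simp: \<phi>_def a_def abs_mult field_simps intro!: bump_eq_0)
    qed
    show "\<phi> n 0 = f 0" by (simp add: \<phi>_def bump_0)
    have 1: "\<bar>f x * bump (a n * x)\<bar> \<le> B * A" "\<bar>f' x * bump (a n * x)\<bar> \<le> B * A"
      unfolding abs_mult using A B pos by (auto intro!: mult_mono)
    have "\<bar>deriv bump (a n * x) * a n\<bar> \<le> A' * 1"
      unfolding abs_mult using A a[of n] pos by (intro mult_mono) auto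
    then have 2: "\<bar>deriv bump (a n * x) * a n * f x\<bar> \<le> A' * B"
      unfolding abs_mult[of _ "f x"] using B pos by (intro mult_mono) auto
    show "\<bar>\<phi> n x\<bar> \<le> B * A + A' * B"
      using 1(1) pos by (simp add: \<phi>_def add_increasing2)
    show "\<bar>deriv (\<phi> n) x\<bar> \<le> B * A + A' * B"
      unfolding d' using 1(2) 2 abs_triangle_ineq[of "f' x * bump (a n * x)" "deriv bump (a n * x) * a n * f x"] by linarith
    show "(\<lambda>n. \<phi> n x) \<longlonglongrightarrow> f x"
      using tendsto_mult[OF tendsto_const[of "f x"] lim_bump] by (simp add: \<phi>_def)
    have "(\<lambda>n. deriv bump (a n * x) * a n) \<longlonglongrightarrow> 0"
    proof (rule Lim_null_comparison)
      show "\<forall>\<^sub>F n in sequentially. norm (deriv bump (a n * x) * a n) \<le> A' * a n"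
        using A(2) a(1) by (intro always_eventually allI) (simp add: abs_mult mult_right_mono less_imp_le)
      show "(\<lambda>n. A' * a n) \<longlonglongrightarrow> 0" using tendsto_mult_right_zero[OF a0] by simp
    qed
    from tendsto_add[OF tendsto_mult[OF tendsto_const[of "f' x"] lim_bump] tendsto_mult[OF this tendsto_const[of "f x"]]]
    show "(\<lambda>n. deriv (\<phi> n) x) \<longlonglongrightarrow> f' x"
      unfolding d' by simp
  qed
qed

section \<open>Weakly continuous families of measures\<close>

context
  fixes Q :: "real \<Rightarrow> real measure"
  assumes Q: "weakly_continuous_family Q"
begin

lemma family_finite: "t \<ge> 0 \<Longrightarrow> finite_measure (Q t)"
  and family_sets: "t \<ge> 0 \<Longrightarrow> sets (Q t) = sets borel"
  using Q unfolding weakly_continuous_family_def by auto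

lemma family_mean_continuous:
  fixes f :: "real \<Rightarrow> real"
  assumes "continuous_on UNIV f" "\<And>r. \<bar>f r\<bar> \<le> B"
  shows "continuous_on {0..} (\<lambda>t. LINT r|Q t. f r)"
proof -
  have "bounded (range f)" using assms(2) by (auto simp: bounded_iff)
  then show ?thesis using Q assms(1) unfolding weakly_continuous_family_def by blast
qed

lemma family_space: "t \<ge> 0 \<Longrightarrow> space (Q t) = UNIV"
  by (drule family_sets, drule sets_eq_imp_space_eq) simp

lemma family_measurable: 
  "t \<ge> 0 \<Longrightarrow> f \<in> borel_measurable borel \<Longrightarrow> f \<in> borel_measurable (Q t)"
  by (drule family_sets, drule measurable_cong_sets[OF _ refl, of _ _ borel]) blast

lemma family_integrable:
  fixes f :: "real \<Rightarrow> 'b :: {banach, second_countable_topology}"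
  assumes "t \<ge> 0" "f \<in> borel_measurable borel" "\<And>r. norm (f r) \<le> B"
  shows "integrable (Q t) f"
  by (rule finite_measure.integrable_const_bound[OF family_finite[OF assms(1)], of _ B])
    (simp_all add: assms family_measurable)

lemma family_mean_bound:
  fixes f :: "real \<Rightarrow> real"
  assumes "t \<ge> 0" "\<And>r. \<bar>f r\<bar> \<le> B" "f \<in> borel_measurable borel"
  shows "\<bar>LINT r|Q t. f r\<bar> \<le> B * (LINT r|Q t. 1)"
proof -
  have "norm (LINT r|Q t. f r) \<le> (LINT r|Q t. B)"
  proof (rule Bochner_Integration.integral_norm_bound_integral)
    show "integrable (Q t) f" by (rule family_integrable[OF assms(1,3), of B]) (simp add: assms(2))
    show "integrable (Q t) (\<lambda>_. B)" by (rule family_integrable[OF assms(1), of _ "\<bar>B\<bar>"]) auto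
  qed (simp add: assms(2))
  then show ?thesis by (simp add: mult.commute)
qed

lemma mass_continuous: "continuous_on {0..} (\<lambda>t. LINT r|Q t. (1::real))"
  by (rule family_mean_continuous[of _ 1]) auto

lemma mean_tendsto:
  fixes f :: "real \<Rightarrow> real"
  assumes "t \<ge> 0" "\<And>n x. \<bar>\<phi> n x\<bar> \<le> C" "\<And>x. (\<lambda>n. \<phi> n x) \<longlonglongrightarrow> f x"
    "\<And>n. \<phi> n \<in> borel_measurable borel" "f \<in> borel_measurable borel"
  shows "(\<lambda>n. LINT r|Q t. \<phi> n r) \<longlonglongrightarrow> (LINT r|Q t. f r)"
proof (rule integral_dominated_convergence)
  show "integrable (Q t) (\<lambda>_. C)"
    by (rule family_integrable[OF assms(1), of _ "\<bar>C\<bar>"]) auto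
  show "f \<in> borel_measurable (Q t)" "\<phi> n \<in> borel_measurable (Q t)" for n
    using assms(4,5) family_measurable[OF assms(1)] by blast+
  show "AE x in Q t. (\<lambda>n. \<phi> n x) \<longlonglongrightarrow> f x" "AE x in Q t. norm (\<phi> n x) \<le> C" for n
    using assms(2,3) by simp_all
qed

lemma integrated_test:
  assumes \<beta>: "0 < \<beta>" "\<beta> < 1" and sol: "solves_fractional_drift \<beta> Q" and \<phi>: "test_function \<phi>" and "t \<ge> 0"
  shows "caputo_integral \<beta> (\<lambda>u. (LINT r|Q u. \<phi> r) - \<phi> 0) t =
     Gamma (1 - \<beta>) * caputo_integral 0 (\<lambda>u. LINT r|Q u. deriv \<phi> r) t"
proof -
  obtain B B' where c: "continuous_on UNIV \<phi>" "continuous_on UNIV (deriv \<phi>)"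
    and b: "\<And>x. \<bar>\<phi> x\<bar> \<le> B" "\<And>x. \<bar>deriv \<phi> x\<bar> \<le> B'"
    by (rule test_functionD[OF \<phi>]) blast
  have Q0: "Q 0 = return borel 0"
    and eq: "\<forall>t>0. caputo_differentiable \<beta> (\<lambda>u. LINT r|Q u. \<phi> r) t \<and>
        caputo_deriv \<beta> (\<lambda>u. LINT r|Q u. \<phi> r) t = (LINT r|Q t. deriv \<phi> r)"
    using sol \<phi> unfolding solves_fractional_drift_def by blast+
  have "(LINT r|Q 0. \<phi> r) = \<phi> 0"
    unfolding Q0 by (rule integral_return) (auto intro: borel_measurable_continuous_onI c)
  then show ?thesis
    using eq[unfolded caputo_iff_integrated[OF \<beta> family_mean_continuous[OF c(1) b(1)] family_mean_continuous[OF c(2) b(2)]]]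
      \<open>t \<ge> 0\<close> by simp
qed

text \<open>
  The total mass is continuous, hence bounded on \<open>{0..t}\<close>, so the cutoffs can be removed by dominated
  convergence.
\<close>
lemma integrated_bounded:
  assumes \<beta>: "0 < \<beta>" "\<beta> < 1" and sol: "solves_fractional_drift \<beta> Q" and t: "t \<ge> 0"
    and f: "\<And>n. times_differentiable n f"
    and f': "\<And>x. (f has_real_derivative f' x) (at x)" "continuous_on UNIV f'"
    and B: "\<And>x. \<bar>f x\<bar> \<le> B" "\<And>x. \<bar>f' x\<bar> \<le> B"
  shows "caputo_integral \<beta> (\<lambda>u. (LINT r|Q u. f r) - f 0) t =
     Gamma (1 - \<beta>) * caputo_integral 0 (\<lambda>u. LINT r|Q u. f' r) t"
proof -
  obtain \<phi> C where test: "\<And>n::nat. test_function (\<phi> n)" and \<phi>0: "\<And>n. \<phi> n 0 = f 0"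
    and C: "\<And>n x. \<bar>\<phi> n x\<bar> \<le> C" "\<And>n x. \<bar>deriv (\<phi> n) x\<bar> \<le> C"
    and lim: "\<And>x. (\<lambda>n. \<phi> n x) \<longlonglongrightarrow> f x" "\<And>x. (\<lambda>n. deriv (\<phi> n) x) \<longlonglongrightarrow> f' x"
    by (rule cutoff_sequence[OF f f'(1) B]) blast
  have C0: "C \<ge> 0" using C(1)[of 0 0] by linarith
  have c: "continuous_on UNIV (\<phi> n)" "continuous_on UNIV (deriv (\<phi> n))" for n
    by (rule test_functionD[OF test[of n]], blast)+
  have fc: "continuous_on UNIV f"
    using f'(1) by (meson DERIV_continuous_on has_field_derivative_at_within)
  have "bounded ((\<lambda>t. LINT r|Q t. (1::real)) ` {0..t})"
    by (intro compact_imp_bounded compact_continuous_image continuous_on_subset[OF mass_continuous]) auto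
  then obtain M where M: "\<forall>u\<in>{0..t}. \<bar>LINT r|Q u. (1::real)\<bar> \<le> M" by (auto simp: bounded_iff)
  have bd: "\<bar>LINT r|Q (t * v). \<psi> r\<bar> \<le> C * M" 
    if "0 \<le> v" "v \<le> 1" "\<And>x. \<bar>\<psi> x\<bar> \<le> C" "continuous_on UNIV \<psi>" for v \<psi>
  proof -
    have v: "t * v \<in> {0..t}" using that t by (auto intro: mult_left_le)
    then have "\<bar>LINT r|Q (t * v). \<psi> r\<bar> \<le> C * (LINT r|Q (t * v). 1)"
      using that by (intro family_mean_bound) (auto intro!: borel_measurable_continuous_onI)
    also have "\<dots> \<le> C * M"
      using M v C0 by (intro mult_left_mono) (auto simp: abs_le_iff)
    finally show ?thesis .
  qed
  have meas: "\<phi> n \<in> borel_measurable borel" "deriv (\<phi> n) \<in> borel_measurable borel"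
    "f \<in> borel_measurable borel" "f' \<in> borel_measurable borel" for n
    using c fc f' by (auto intro: borel_measurable_continuous_onI)
  have L: "(\<lambda>n. caputo_integral \<beta> (\<lambda>u. (LINT r|Q u. \<phi> n r) - f 0) t) \<longlonglongrightarrow>
        caputo_integral \<beta> (\<lambda>u. (LINT r|Q u. f r) - f 0) t"
  proof (rule caputo_integral_tendsto)
    show "continuous_on {0..} (\<lambda>u. (LINT r|Q u. \<phi> n r) - f 0)" for n
      by (intro continuous_intros family_mean_continuous[OF c(1) C(1)])
    show "continuous_on {0..} (\<lambda>u. (LINT r|Q u. f r) - f 0)"
      by (intro continuous_intros family_mean_continuous[OF fc B(1)])
    fix v :: real assume v: "0 \<le> v" "v \<le> 1"
    show "(\<lambda>n. (LINT r|Q (t * v). \<phi> n r) - f 0) \<longlonglongrightarrow> (LINT r|Q (t * v). f r) - f 0"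
      by (intro tendsto_diff tendsto_const mean_tendsto[OF _ C(1) lim(1)] meas) (use v t in auto)
    show "\<bar>(LINT r|Q (t * v). \<phi> n r) - f 0\<bar> \<le> C * M + \<bar>f 0\<bar>" for n
      using bd[OF v C(1) c(1), of n] by linarith
  qed (use \<beta> t in auto)
  have R: "(\<lambda>n. caputo_integral 0 (\<lambda>u. LINT r|Q u. deriv (\<phi> n) r) t) \<longlonglongrightarrow>
        caputo_integral 0 (\<lambda>u. LINT r|Q u. f' r) t"
  proof (rule caputo_integral_tendsto)
    show "continuous_on {0..} (\<lambda>u. (LINT r|Q u. deriv (\<phi> n) r))" for n
      by (intro continuous_intros family_mean_continuous[OF c(2) C(2)])
    show "continuous_on {0..} (\<lambda>u. (LINT r|Q u. f' r))"
      by (intro continuous_intros family_mean_continuous[OF f'(2) B(2)])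
    fix v :: real assume v: "0 \<le> v" "v \<le> 1"
    show "(\<lambda>n. (LINT r|Q (t * v). deriv (\<phi> n) r)) \<longlonglongrightarrow> (LINT r|Q (t * v). f' r)"
      by (intro mean_tendsto[OF _ C(2) lim(2)] meas) (use v t in auto)
    show "\<bar>(LINT r|Q (t * v). deriv (\<phi> n) r)\<bar> \<le> C * M" for n
      using bd[OF v C(2) c(2), of n] by linarith
  qed (use t in auto)
  have "caputo_integral \<beta> (\<lambda>u. (LINT r|Q u. \<phi> n r) - f 0) t =
      Gamma (1 - \<beta>) * caputo_integral 0 (\<lambda>u. LINT r|Q u. deriv (\<phi> n) r) t" for n
    using integrated_test[OF \<beta> sol test t, of n] by (simp add: \<phi>0)
  then have "(\<lambda>n. Gamma (1 - \<beta>) * caputo_integral 0 (\<lambda>u. LINT r|Q u. deriv (\<phi> n) r) t) \<longlonglongrightarrow>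
        caputo_integral \<beta> (\<lambda>u. (LINT r|Q u. f r) - f 0) t"
    using L by simp
  then show ?thesis
    by (rule LIMSEQ_unique) (rule tendsto_mult[OF tendsto_const R])
qed

lemma integrated_trig:
  assumes \<beta>: "0 < \<beta>" "\<beta> < 1" and sol: "solves_fractional_drift \<beta> Q" and t: "t \<ge> 0"
  shows "caputo_integral \<beta> (\<lambda>u. (LINT r|Q u. a * cos (\<kappa> * r) + b * sin (\<kappa> * r)) - a) t =
     Gamma (1 - \<beta>) * caputo_integral 0 (\<lambda>u. LINT r|Q u. b * \<kappa> * cos (\<kappa> * r) - a * \<kappa> * sin (\<kappa> * r)) t"
proof -
  have tb: "\<bar>c * cos x + d * sin x\<bar> \<le> \<bar>c\<bar> + \<bar>d\<bar>" for c d x :: real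
  proof -
    have "\<bar>c * cos x\<bar> \<le> \<bar>c\<bar> * 1" "\<bar>d * sin x\<bar> \<le> \<bar>d\<bar> * 1"
      unfolding abs_mult by (rule mult_left_mono; simp)+
    then show ?thesis by linarith
  qed
  let ?B = "\<bar>a\<bar> + \<bar>b\<bar> + \<bar>b * \<kappa>\<bar> + \<bar>- a * \<kappa>\<bar>"
  have B1: "\<bar>a * cos (\<kappa> * x) + b * sin (\<kappa> * x)\<bar> \<le> ?B" for x using tb[of a "\<kappa> * x" b] by linarith
  have B2: "\<bar>b * \<kappa> * cos (\<kappa> * x) - a * \<kappa> * sin (\<kappa> * x)\<bar> \<le> ?B" for x 
    using tb[of "b * \<kappa>" "\<kappa> * x" "- a * \<kappa>"] by simp
  show ?thesis
  proof -
    have d: "((\<lambda>x. a * cos (\<kappa> * x) + b * sin (\<kappa> * x)) has_real_derivative b * \<kappa> * cos (\<kappa> * x) - a * \<kappa> * sin (\<kappa> * x)) (at x)" for x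
      by (auto intro!: derivative_eq_intros)
    have c: "continuous_on UNIV (\<lambda>x. b * \<kappa> * cos (\<kappa> * x) - a * \<kappa> * sin (\<kappa> * x))"
      by (intro continuous_intros)
    show ?thesis
      using integrated_bounded[OF \<beta> sol t times_differentiable_trig d c B1 B2] by simp
  qed
qed

lemma mass_one:
  assumes "\<And>s. s > 0 \<Longrightarrow> laplace_integrable (\<lambda>t. LINT r|Q t. (1::real)) s"
    and "\<And>s. s > 0 \<Longrightarrow> laplace (\<lambda>t. LINT r|Q t. (1::real)) s = 1 / s" and "t \<ge> 0"
  shows "prob_space (Q t)"
proof -
  have "(LINT r|Q t. (1::real)) = 1"
    using assms laplace_const
    by (intro laplace_unique[of "\<lambda>t. LINT r|Q t. (1::real)" "\<lambda>_. 1"] mass_continuous)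
      (auto intro!: laplace_integrable_bounded[of _ 1])
  then have "measure (Q t) (space (Q t)) = 1" by simp
  then have "emeasure (Q t) (space (Q t)) = 1"
    using finite_measure.emeasure_eq_measure[OF family_finite[OF \<open>t \<ge> 0\<close>]] by simp
  then show ?thesis by (rule prob_spaceI)
qed

end

text \<open>
  No growth condition on \<open>Q\<close> is available, so convergence of the Laplace transform of the total mass has
  to come from the equation.  Truncations of \<open>m\<close> have transforms, and by positivity their Caputo
  integrals stay below that of a constant; hence their transforms are bounded by \<open>c / s\<close>, and
  monotone convergence applies.
\<close>
lemma laplace_integrable_of_caputo_bound:
  fixes m :: "real \<Rightarrow> real"
  assumes m: "continuous_on {0..} m" "\<And>t. t \<ge> 0 \<Longrightarrow> m t \<ge> 0" and \<beta>: "\<beta> < 1" and s: "s > 0"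
    and le: "\<And>t. t \<ge> 0 \<Longrightarrow> caputo_integral \<beta> m t \<le> caputo_integral \<beta> (\<lambda>_. c) t"
  shows "laplace_integrable m s"
proof -
  define w where "w n t = max 0 (min 1 (real n - t))" for n :: nat and t
  define mn where "mn n t = m t * w n t" for n t
  have w: "0 \<le> w n t" "w n t \<le> 1" for n t by (auto simp: w_def)
  have mc: "continuous_on {0..} (mn n)" for n
    unfolding mn_def w_def by (intro continuous_intros m)
  have mle: "0 \<le> mn n t" "mn n t \<le> m t" if "t \<ge> 0" for n t
    using m(2)[OF that] w[of n t] by (auto simp: mn_def mult_left_le)
  have li: "laplace_integrable (mn n) s" for n
  proof -
    have "bounded (m ` {0..real n})"
      by (intro compact_imp_bounded compact_continuous_image continuous_on_subset[OF m(1)]) auto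
    then obtain B where B: "\<forall>u\<in>{0..real n}. \<bar>m u\<bar> \<le> B" by (auto simp: bounded_iff)
    have "\<bar>mn n t\<bar> \<le> \<bar>B\<bar>" if "t \<ge> 0" for t
    proof (cases "t \<le> real n")
      case True
      then have "\<bar>m t\<bar> \<le> \<bar>B\<bar>" using B that by force
      then show ?thesis using mle[OF that, of n] by linarith
    qed (simp add: mn_def w_def)
    then show ?thesis by (intro laplace_integrable_bounded[of _ "\<bar>B\<bar>"] mc s) auto
  qed
  have bound: "laplace (mn n) s \<le> c / s" for n
  proof -
    have "caputo_integral \<beta> (mn n) t \<le> caputo_integral \<beta> (\<lambda>_. c) t" if "t \<ge> 0" for t
    proof -
      have "caputo_integral \<beta> (mn n) t \<le> caputo_integral \<beta> m t"
        unfolding caputo_integral_scaled[OF that \<beta>]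
      proof (rule mult_left_mono[OF integral_mono[OF integrable_caputo_scaled[OF mc that \<beta>]
              integrable_caputo_scaled[OF m(1) that \<beta>]]])
        fix v :: real
        show "indicator {0..1} v / (1 - v) powr \<beta> * mn n (t * v) \<le> indicator {0..1} v / (1 - v) powr \<beta> * m (t * v)"
          using mle(2)[of "t * v" n] that by (cases "v \<in> {0..1}") (auto intro: divide_right_mono)
      qed simp
      with le[OF that] show ?thesis by simp
    qed
    moreover have ic: "laplace_integrable (\<lambda>_. c) s"
      using s by (intro laplace_integrable_bounded[of _ "\<bar>c\<bar>"]) auto
    ultimately have "laplace (caputo_integral \<beta> (mn n)) s \<le> laplace (caputo_integral \<beta> (\<lambda>_. c)) s"
      using laplace_caputo_integral(1)[OF li[of n] s \<beta>] laplace_caputo_integral(1)[OF ic s \<beta>]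
      unfolding laplace_def laplace_integrable_def
      by (intro set_integral_mono) (auto intro: mult_left_mono)
    then show ?thesis
      unfolding laplace_caputo_integral(2)[OF li[of n] s \<beta>] laplace_caputo_integral(2)[OF ic s \<beta>] laplace_const[OF s]
      using \<beta> s by (simp add: Gamma_real_pos del: times_divide_eq_right)
  qed
  let ?f = "\<lambda>n t. indicator {0..} t *\<^sub>R (exp (- s * t) *\<^sub>R mn n t)"
  let ?u = "\<lambda>t. indicator {0..} t *\<^sub>R (exp (- s * t) *\<^sub>R m t)"
  have fi: "integrable lborel (?f n)" for n
    using li by (simp add: laplace_integrable_def set_integrable_def)
  have fb: "(LINT t|lborel. ?f n t) \<le> c / s" for n
    using bound by (simp add: laplace_def set_lebesgue_integral_def)
  have mono: "mono (\<lambda>n. ?f n t)" for t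
    using m(2)[of t] by (intro monoI) (auto simp: indicator_def mn_def w_def intro!: mult_left_mono)
  have "incseq (\<lambda>n. LINT t|lborel. ?f n t)"
    using mono fi by (intro monoI integral_mono) (auto dest: monoD)
  then obtain x where x: "(\<lambda>n. LINT t|lborel. ?f n t) \<longlonglongrightarrow> x"
    using incseq_convergent[of _ "c / s"] fb by blast
  have "integrable lborel ?u"
  proof (rule integrable_monotone_convergence[OF fi _ _ x])
    show "AE t in lborel. mono (\<lambda>n. ?f n t)" using mono by simp
    show "AE t in lborel. (\<lambda>n. ?f n t) \<longlonglongrightarrow> ?u t"
    proof (intro always_eventually allI)
      fix t :: real
      have "\<forall>\<^sub>F n in sequentially. w n t = 1"
        using filterlim_real_sequentially unfolding filterlim_at_top
        by (auto simp: w_def elim!: eventually_mono dest!: spec[of _ "t + 1"])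
      then have "\<forall>\<^sub>F n in sequentially. ?f n t = ?u t"
        by eventually_elim (simp add: mn_def)
      then show "(\<lambda>n. ?f n t) \<longlonglongrightarrow> ?u t" by (rule tendsto_eventually)
    qed
    have "continuous_on {0..} (\<lambda>t. exp (- s * t) *\<^sub>R m t)" by (intro continuous_intros m)
    then show "?u \<in> borel_measurable lborel"
      using borel_measurable_continuous_on_indicator[of "{0..}" "\<lambda>t. exp (- s * t) *\<^sub>R m t"] by simp
  qed
  then show ?thesis by (simp add: laplace_integrable_def set_integrable_def)
qed

section \<open>The Fourier-Laplace equation of a solution\<close>

lemma Re_Im_laplace:
  assumes "laplace_integrable c s"
  shows "Re (laplace c s) = laplace (\<lambda>t. Re (c t)) s" "Im (laplace c s) = laplace (\<lambda>t. Im (c t)) s"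
    "laplace_integrable (\<lambda>t. Re (c t)) s"
proof -
  have i: "integrable lborel (\<lambda>t. indicator {0..} t *\<^sub>R (exp (- s * t) *\<^sub>R c t))"
    using assms by (simp add: laplace_integrable_def set_integrable_def)
  show "Re (laplace c s) = laplace (\<lambda>t. Re (c t)) s" "Im (laplace c s) = laplace (\<lambda>t. Im (c t)) s"
    unfolding laplace_def set_lebesgue_integral_def
    by (rule trans[OF integral_Re[OF i, symmetric]], simp add: mult.assoc,
        rule trans[OF integral_Im[OF i, symmetric]], simp add: mult.assoc)
  show "laplace_integrable (\<lambda>t. Re (c t)) s"
    using integrable_Re[OF i] by (simp add: laplace_integrable_def set_integrable_def mult.assoc)
qed

lemma drift_eq_iff:
  assumes "s > 0"
  shows "drift_eq \<beta> \<kappa> s x \<longleftrightarrow> x = q0_hat \<beta> \<kappa> s"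
proof -
  have ne: "of_real (s powr \<beta>) - \<i> * of_real \<kappa> \<noteq> (0::complex)"
    using assms by (auto simp: complex_eq_iff)
  have "s powr (\<beta> - 1) * s = s powr \<beta>" using assms by (simp add: powr_diff)
  then have "of_real (s powr (\<beta> - 1)) * of_real s = (of_real (s powr \<beta>) :: complex)"
    by (metis of_real_mult)
  then have "drift_eq \<beta> \<kappa> s x \<longleftrightarrow> of_real (s powr \<beta>) * x - of_real (s powr (\<beta> - 1)) = \<i> * of_real \<kappa> * x"
    by (simp add: drift_eq_def right_diff_distrib flip: mult.assoc)
  also have "\<dots> \<longleftrightarrow> x = q0_hat \<beta> \<kappa> s"
    using ne by (auto simp: q0_hat_def field_simps)
  finally show ?thesis .
qed

context
  fixes Q :: "real \<Rightarrow> real measure"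
  assumes Q: "weakly_continuous_family Q"
begin

lemma char_family:
  assumes "t \<ge> 0"
  shows "Re (char (Q t) \<kappa>) = (LINT r|Q t. cos (\<kappa> * r))" "Im (char (Q t) \<kappa>) = (LINT r|Q t. sin (\<kappa> * r))"
proof -
  have i: "integrable (Q t) (\<lambda>r. iexp (\<kappa> * r))"
    by (rule family_integrable[OF Q assms, of _ 1]) auto
  show "Re (char (Q t) \<kappa>) = (LINT r|Q t. cos (\<kappa> * r))" "Im (char (Q t) \<kappa>) = (LINT r|Q t. sin (\<kappa> * r))"
    unfolding char_def integral_Re[OF i, symmetric] integral_Im[OF i, symmetric] by (simp_all add: Re_exp Im_exp)
qed

lemma char_family_continuous: "continuous_on {0..} (\<lambda>t. char (Q t) \<kappa>)"
proof -
  have "continuous_on {0..} (\<lambda>t. Complex (LINT r|Q t. cos (\<kappa> * r)) (LINT r|Q t. sin (\<kappa> * r)))"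
    by (intro continuous_on_Complex family_mean_continuous[OF Q, of _ 1] continuous_intros) auto
  then show ?thesis
    by (rule continuous_on_eq) (auto simp: complex_eq_iff char_family)
qed

lemma solves_imp_drift_eq:
  assumes \<beta>: "0 < \<beta>" "\<beta> < 1" and sol: "solves_fractional_drift \<beta> Q" and s: "s > 0"
  shows "drift_eq \<beta> \<kappa> s (fourier_laplace Q \<kappa> s)"
proof -
  let ?m = "\<lambda>t. LINT r|Q t. (1::real)"
  note trig = integrated_trig[OF Q \<beta> sol]
  have m0: "caputo_integral \<beta> (\<lambda>u. ?m u - 1) t = Gamma (1 - \<beta>) * caputo_integral 0 (\<lambda>u. 0) t" if "t \<ge> 0" for t
    using trig[OF that, of 1 0 0] by simp
  have mi: "laplace_integrable ?m s" if "s > 0" for s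
  proof (rule laplace_integrable_of_caputo_bound[OF mass_continuous[OF Q] _ \<beta>(2) that])
    fix t :: real assume t: "t \<ge> 0"
    have "caputo_integral \<beta> ?m t - caputo_integral \<beta> (\<lambda>_. 1) t = 0"
      using m0[OF t] caputo_integral_diff[OF mass_continuous[OF Q] continuous_on_const t \<beta>(2), of 1]
        caputo_integral_const[OF t, of 0 0] by simp
    then show "caputo_integral \<beta> ?m t \<le> caputo_integral \<beta> (\<lambda>_. 1) t" by simp
  qed simp
  have zi: "laplace_integrable (\<lambda>_. 0::real) s" for s
    by (simp add: laplace_integrable_def set_integrable_def)
  have "\<forall>s>0. s powr \<beta> * laplace ?m s - s powr (\<beta> - 1) * 1 = laplace (\<lambda>_. 0) s"
    using m0 integrated_iff_laplace[OF \<beta> mass_continuous[OF Q] continuous_on_const mi zi, of 1] by simp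
  then have "laplace ?m s = 1 / s" if "s > 0" for s
    using that laplace_const[OF that, of 0] by (auto simp: powr_diff field_simps)
  then have prob: "prob_space (Q t)" if "t \<ge> 0" for t
    using mass_one[OF Q mi _ that] by blast
  have norm: "norm (char (Q t) \<kappa>) \<le> 1" if "t \<ge> 0" for t
    using real_distribution.cmod_char_le_1[of "Q t"] prob[OF that] family_sets[OF Q that]
    by (simp add: real_distribution_def real_distribution_axioms_def)
  have ci: "laplace_integrable (\<lambda>t. char (Q t) \<kappa>) s" if "s > 0" for s
    by (rule laplace_integrable_bounded[OF char_family_continuous norm that])
  let ?c = "\<lambda>t. LINT r|Q t. cos (\<kappa> * r)" and ?s = "\<lambda>t. LINT r|Q t. sin (\<kappa> * r)"
  have cont: "continuous_on {0..} ?c" "continuous_on {0..} ?s"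
    by (intro family_mean_continuous[OF Q, of _ 1] continuous_intros; simp)+
  have b: "\<bar>?c t\<bar> \<le> 1" "\<bar>?s t\<bar> \<le> 1" if "t \<ge> 0" for t
    using norm[OF that] abs_Re_le_cmod[of "char (Q t) \<kappa>"] abs_Im_le_cmod[of "char (Q t) \<kappa>"] char_family[OF that, of \<kappa>]
    by linarith+
  have li: "laplace_integrable ?c s" "laplace_integrable ?s s" if "s > 0" for s
    by (auto intro!: laplace_integrable_bounded[OF _ _ that, of _ 1] cont b)
  have eqc: "s powr \<beta> * laplace ?c s - s powr (\<beta> - 1) * 1 = laplace (\<lambda>t. - \<kappa> * ?s t) s"
    using trig[of _ 1 \<kappa> 0] s
    by (intro integrated_iff_laplace[THEN iffD1, rule_format, OF \<beta> cont(1) continuous_on_mult_left[OF cont(2)]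
          li(1) laplace_cmult(1)[OF li(2)]]) auto
  have eqs: "s powr \<beta> * laplace ?s s - s powr (\<beta> - 1) * 0 = laplace (\<lambda>t. \<kappa> * ?c t) s"
    using trig[of _ 0 \<kappa> 1] s
    by (intro integrated_iff_laplace[THEN iffD1, rule_format, OF \<beta> cont(2) continuous_on_mult_left[OF cont(1)]
          li(2) laplace_cmult(1)[OF li(1)]]) auto
  have fl: "Re (fourier_laplace Q \<kappa> s) = laplace ?c s" "Im (fourier_laplace Q \<kappa> s) = laplace ?s s"
    unfolding fourier_laplace_def Re_Im_laplace(1,2)[OF ci[OF s]]
    unfolding laplace_def by (auto intro!: set_lebesgue_integral_cong simp: char_family)
  have "Re (of_real (s powr \<beta>) * fourier_laplace Q \<kappa> s - of_real (s powr (\<beta> - 1))) = Re (\<i> * of_real \<kappa> * fourier_laplace Q \<kappa> s)"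
    "Im (of_real (s powr \<beta>) * fourier_laplace Q \<kappa> s - of_real (s powr (\<beta> - 1))) = Im (\<i> * of_real \<kappa> * fourier_laplace Q \<kappa> s)"
    using eqc eqs laplace_cmult(2)[OF li(2)[OF s], of "- \<kappa>"] laplace_cmult(2)[OF li(1)[OF s], of "\<kappa>"]
    by (simp_all add: fl)
  then have e: "of_real (s powr \<beta>) * fourier_laplace Q \<kappa> s - of_real (s powr (\<beta> - 1)) = \<i> * of_real \<kappa> * fourier_laplace Q \<kappa> s"
    by (rule complex_eqI)
  have "of_real (s powr (\<beta> - 1)) * of_real s = (of_real (s powr \<beta>) :: complex)"
    using s by (simp add: powr_diff)
  with e show ?thesis
    by (simp add: drift_eq_def right_diff_distrib flip: mult.assoc)
qed

text \<open>
  A divergent \<open>laplace\<close> integral has the value \<open>0\<close>, which does not solve the equation; so the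
  transform of the total mass converges, and it equals \<open>1 / s\<close>.
\<close>
lemma drift_eq_imp_prob:
  assumes eq: "\<And>s. s > 0 \<Longrightarrow> drift_eq \<beta> 0 s (fourier_laplace Q 0 s)" and t: "t \<ge> 0"
  shows "prob_space (Q t)"
proof -
  have fl: "fourier_laplace Q 0 s = of_real (1 / s)" if "s > 0" for s
    using eq[OF that] that unfolding drift_eq_iff[OF that] by (simp add: q0_hat_def powr_diff)
  have li: "laplace_integrable (\<lambda>t. char (Q t) 0) s" if "s > 0" for s
  proof (rule ccontr)
    assume "\<not> ?thesis"
    then have "fourier_laplace Q 0 s = 0"
      by (simp add: fourier_laplace_def laplace_def laplace_integrable_def set_lebesgue_integral_def
          set_integrable_def not_integrable_integral_eq)
    then show False using fl[OF that] that by simp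
  qed
  have c: "Re (char (Q t) 0) = (LINT r|Q t. (1::real))" if "t \<ge> 0" for t
    using char_family(1)[OF that, of 0] by simp
  show ?thesis
  proof (rule mass_one[OF Q _ _ t])
    fix s :: real assume s: "s > 0"
    show "laplace_integrable (\<lambda>t. LINT r|Q t. (1::real)) s"
      using Re_Im_laplace(3)[OF li[OF s]] unfolding laplace_integrable_def
      by (subst (asm) set_integrable_cong[OF refl refl]) (auto simp: c)
    have "laplace (\<lambda>t. LINT r|Q t. (1::real)) s = laplace (\<lambda>t. Re (char (Q t) 0)) s"
      unfolding laplace_def by (intro set_lebesgue_integral_cong) (auto simp: c)
    also have "\<dots> = 1 / s"
      using Re_Im_laplace(1)[OF li[OF s]] fl[OF s] by (simp add: fourier_laplace_def)
    finally show "laplace (\<lambda>t. LINT r|Q t. (1::real)) s = 1 / s" .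
  qed
qed

end

section \<open>Exponential laws\<close>

text \<open>
  As \<open>f - f 0 = caputo_integral 0 f'\<close>, the multiplier \<open>1 / s\<close> of \<open>caputo_integral 0\<close> replaces the
  integration by parts.
\<close>
lemma laplace_deriv:
  fixes f f' :: "real \<Rightarrow> real"
  assumes f': "\<And>x. (f has_real_derivative f' x) (at x)" "continuous_on UNIV f'"
    and B: "\<And>x. \<bar>f x\<bar> \<le> B" "\<And>x. \<bar>f' x\<bar> \<le> B" and s: "s > 0"
  shows "laplace f' s = s * laplace f s - f 0"
proof -
  have fc: "continuous_on {0..} f"
    using f'(1) by (meson DERIV_continuous_on has_field_derivative_at_within)
  have f'c: "continuous_on {0..} f'" by (rule continuous_on_subset[OF f'(2)]) simp
  have i: "laplace_integrable f s" "laplace_integrable f' s" "laplace_integrable (\<lambda>_. f 0) s"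
    using laplace_integrable_bounded[OF fc _ s, of B] laplace_integrable_bounded[OF f'c _ s, of B]
      laplace_integrable_bounded[OF continuous_on_const _ s, of "f 0" B] B by simp_all
  have "caputo_integral 0 f' t = f t - f 0" if "t \<ge> 0" for t
  proof -
    have "(f' has_integral f t - f 0) {0..t}"
      using f'(1) that by (intro fundamental_theorem_of_calculus)
        (auto simp: has_real_derivative_iff_has_vector_derivative[symmetric] has_field_derivative_at_within)
    then show ?thesis by (simp add: caputo_integral_0[OF f'c that] integral_unique)
  qed
  then have "laplace (caputo_integral 0 f') s = laplace (\<lambda>t. f t - f 0) s"
    unfolding laplace_def by (intro set_lebesgue_integral_cong) auto
  then show ?thesis
    unfolding laplace_diff(2)[OF i(1,3)] laplace_const[OF s]
    using laplace_caputo_integral(2)[OF i(2) s, of 0] s by (simp add: powr_minus_divide field_simps)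
qed

text \<open>
  The density \<open>a exp (- a t)\<close> concentrates at \<open>0\<close> as \<open>a\<close> grows; after scaling \<open>t\<close> by \<open>a\<close> this is dominated
  convergence.
\<close>
lemma laplace_initial_value:
  fixes g :: "real \<Rightarrow> real" and a :: "nat \<Rightarrow> real"
  assumes g: "continuous_on {0..} g" "\<And>t. t \<ge> 0 \<Longrightarrow> \<bar>g t\<bar> \<le> B" and a: "\<And>n. a n > 0" "filterlim a at_top sequentially"
  shows "(\<lambda>n. a n * laplace g (a n)) \<longlonglongrightarrow> g 0"
proof -
  have meas: "(\<lambda>x. indicator {0..} x * (exp (- x) * g (x / c))) \<in> borel_measurable borel" if "c > 0" for c
  proof -
    have "continuous_on {0..} (\<lambda>x. exp (- x) * g (x / c))"
      using that by (intro continuous_intros continuous_on_compose2[OF g(1)]) auto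
    from borel_measurable_continuous_on_indicator[OF _ this] show ?thesis by simp
  qed
  have eq: "a n * laplace g (a n) = (LINT x|lborel. indicator {0..} x * (exp (- x) * g (x / a n)))" for n
  proof -
    have "(LINT x|lborel. indicator {0..} x * (exp (- x) * g (x / a n))) =
      \<bar>a n\<bar> *\<^sub>R (LINT x|lborel. indicator {0..} (0 + a n * x) * (exp (- (0 + a n * x)) * g ((0 + a n * x) / a n)))"
      using a(1)[of n] by (intro lborel_integral_real_affine) simp
    also have "\<dots> = a n * laplace g (a n)"
      using a(1)[of n] by (simp add: laplace_def set_lebesgue_integral_def indicator_def zero_le_mult_iff)
    finally show ?thesis ..
  qed
  have "(\<lambda>n. LINT x|lborel. indicator {0..} x * (exp (- x) * g (x / a n))) \<longlonglongrightarrow>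
        (LINT x|lborel. g 0 * (indicator {0..} x * exp (- 1 * x)))"
  proof (rule integral_dominated_convergence)
    show "integrable lborel (\<lambda>x. B * (indicator {0..} x * exp (- 1 * x)))"
      using integral_exp_Ici(1)[of 1] by (simp del: mult_minus1)
    show "(\<lambda>x. indicator {0..} x * (exp (- x) * g (x / a n))) \<in> borel_measurable lborel" for n
      using meas a by simp
    show "AE x in lborel. (\<lambda>n. indicator {0..} x * (exp (- x) * g (x / a n))) \<longlonglongrightarrow> g 0 * (indicator {0..} x * exp (- 1 * x))"
    proof (intro always_eventually allI)
      fix x :: real
      show "(\<lambda>n. indicator {0..} x * (exp (- x) * g (x / a n))) \<longlonglongrightarrow> g 0 * (indicator {0..} x * exp (- 1 * x))"
      proof (cases "x \<ge> 0")
        case True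
        have "(\<lambda>n. x / a n) \<longlonglongrightarrow> 0"
          by (rule real_tendsto_divide_at_top[OF tendsto_const a(2)])
        then have "(\<lambda>n. g (x / a n)) \<longlonglongrightarrow> g 0"
          by (rule continuous_on_tendsto_compose[OF g(1)])
            (use True a in \<open>auto intro!: always_eventually divide_nonneg_pos\<close>)
        from tendsto_mult[OF tendsto_const[of "exp (- x)"] this] True show ?thesis
          by (simp add: mult.commute)
      qed simp
    qed
    show "AE x in lborel. norm (indicator {0..} x * (exp (- x) * g (x / a n))) \<le> B * (indicator {0..} x * exp (- 1 * x))" for n
      using g(2) a(1)[of n] by (intro always_eventually allI) (auto simp: indicator_def abs_mult mult.commute[of B])
  qed simp
  then show ?thesis
    using integral_exp_Ici(2)[of 1] by (simp add: eq)
qed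

abbreviation exponential :: "real \<Rightarrow> real measure" where
  "exponential a \<equiv> density lborel (exponential_density a)"

lemma integral_exponential:
  fixes f :: "real \<Rightarrow> real"
  assumes "a > 0" "f \<in> borel_measurable borel"
  shows "(LINT x|exponential a. f x) = a * laplace f a"
proof -
  have "(LINT x|exponential a. f x) = (LINT x|lborel. exponential_density a x *\<^sub>R f x)"
    using assms by (intro integral_density) (auto simp: exponential_density_nonneg)
  also have "\<dots> = (LINT x|lborel. a * (indicator {0..} x *\<^sub>R (exp (- a * x) *\<^sub>R f x)))"
    by (intro Bochner_Integration.integral_cong) (auto simp: exponential_density_def indicator_def mult_ac)
  finally show ?thesis by (simp add: laplace_def set_lebesgue_integral_def)
qed

lemma real_distribution_exponential: "a > 0 \<Longrightarrow> real_distribution (exponential a)"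
  using prob_space_exponential_density by (auto simp: real_distribution_def real_distribution_axioms_def)

lemma char_real_distribution:
  assumes "real_distribution M"
  shows "Re (char M \<kappa>) = (LINT r|M. cos (\<kappa> * r))" "Im (char M \<kappa>) = (LINT r|M. sin (\<kappa> * r))"
proof -
  interpret real_distribution M by fact
  have i: "integrable M (\<lambda>r. iexp (\<kappa> * r))" by (rule integrable_iexp) auto
  show "Re (char M \<kappa>) = (LINT r|M. cos (\<kappa> * r))" "Im (char M \<kappa>) = (LINT r|M. sin (\<kappa> * r))"
    unfolding char_def integral_Re[OF i, symmetric] integral_Im[OF i, symmetric] by (simp_all add: Re_exp Im_exp)
qed

text \<open>
  The rule for transforms of derivatives, applied to \<open>cos\<close> and \<open>sin\<close>, gives two linear equations for
  the real and imaginary part.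
\<close>
lemma char_exponential:
  assumes a: "a > 0"
  shows "char (exponential a) \<kappa> = of_real a / (of_real a - \<i> * of_real \<kappa>)"
proof -
  define C where "C = laplace (\<lambda>r. cos (\<kappa> * r)) a"
  define S where "S = laplace (\<lambda>r. sin (\<kappa> * r)) a"
  have k: "\<bar>\<kappa> * x\<bar> \<le> 1 + \<bar>\<kappa>\<bar>" if "\<bar>x\<bar> \<le> 1" for x
    unfolding abs_mult using mult_left_le[OF that, of "\<bar>\<kappa>\<bar>"] by simp
  have k1: "\<bar>x\<bar> \<le> 1 + \<bar>\<kappa>\<bar>" if "\<bar>x\<bar> \<le> 1" for x using that by linarith
  have i: "laplace_integrable (\<lambda>r. cos (\<kappa> * r)) a" "laplace_integrable (\<lambda>r. sin (\<kappa> * r)) a"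
    by (rule laplace_integrable_bounded[of _ 1]; use a in \<open>auto intro!: continuous_intros\<close>)+
  have 1: "\<kappa> * C = a * S"
    unfolding C_def S_def laplace_cmult(2)[OF i(1), symmetric]
    by (subst laplace_deriv[of "\<lambda>r. sin (\<kappa> * r)" _ "1 + \<bar>\<kappa>\<bar>"])
      (auto intro!: derivative_eq_intros continuous_intros k k1[OF abs_cos_le_one] k1[OF abs_sin_le_one] a)
  have 2: "- \<kappa> * S = a * C - 1"
    unfolding C_def S_def laplace_cmult(2)[OF i(2), symmetric]
    by (subst laplace_deriv[of "\<lambda>r. cos (\<kappa> * r)" _ "1 + \<bar>\<kappa>\<bar>"])
      (auto intro!: derivative_eq_intros continuous_intros k k1[OF abs_cos_le_one] k1[OF abs_sin_le_one] a)
  have "Re (char (exponential a) \<kappa>) = a * C" "Im (char (exponential a) \<kappa>) = a * S"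
    unfolding char_real_distribution[OF real_distribution_exponential[OF a]] C_def S_def
    by (auto intro!: integral_exponential a)
  then have "char (exponential a) \<kappa> = Complex (a * C) (a * S)" by (simp add: complex_eq_iff)
  also have "\<dots> * (of_real a - \<i> * of_real \<kappa>) = of_real a"
  proof (rule complex_eqI)
    have "a * C + \<kappa> * S = 1" using 2 by simp
    moreover have "Re (Complex (a * C) (a * S) * (of_real a - \<i> * of_real \<kappa>)) = a * (a * C + \<kappa> * S)"
      by (simp add: algebra_simps)
    ultimately show "Re (Complex (a * C) (a * S) * (of_real a - \<i> * of_real \<kappa>)) = Re (of_real a)"
      by simp
    show "Im (Complex (a * C) (a * S) * (of_real a - \<i> * of_real \<kappa>)) = Im (of_real a)"
      using 1 by (simp add: algebra_simps)
  qed
  finally have "char (exponential a) \<kappa> * (of_real a - \<i> * of_real \<kappa>) = of_real a" .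
  moreover have "of_real a - \<i> * of_real \<kappa> \<noteq> (0::complex)"
    using a by (auto simp: complex_eq_iff)
  ultimately show ?thesis by (simp add: field_simps)
qed

section \<open>From the Fourier-Laplace equation to the solution\<close>

text \<open>
  Only the measures at times \<open>t \<ge> 0\<close> are constrained; a Dirac mass at negative times makes a
  probability kernel on the whole line.
\<close>
definition extended_family :: "(real \<Rightarrow> real measure) \<Rightarrow> real \<Rightarrow> real measure" where
  "extended_family Q t = (if t \<ge> 0 then Q t else return borel 0)"

text \<open>
  Weak continuity gives measurability of \<open>t \<mapsto> Q t {..a}\<close>: the half-line is a pointwise limit of
  bounded continuous ramps, and half-lines generate the Borel sets.
\<close>
lemma extended_family_measurable:
  assumes Q: "weakly_continuous_family Q" and prob: "\<And>t. t \<ge> 0 \<Longrightarrow> prob_space (Q t)"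
  shows "extended_family Q \<in> measurable borel (subprob_algebra borel)"
proof (rule measurable_subprob_algebra_generated)
  show "sets (borel :: real measure) = sigma_sets UNIV (range (\<lambda>a. {..a}))"
    by (subst borel_eq_atMost) simp
  show "Int_stable (range (\<lambda>a::real. {..a}))"
    by (auto simp: Int_stable_def)
  show "subprob_space (extended_family Q t)" for t
    using prob by (auto simp: extended_family_def intro!: prob_space_imp_subprob_space prob_space_return)
  show "sets (extended_family Q t) = sets borel" for t
    using family_sets[OF Q] by (auto simp: extended_family_def)
  show "(\<lambda>t. emeasure (extended_family Q t) UNIV) \<in> borel_measurable borel"
  proof -
    have "emeasure (extended_family Q t) UNIV = 1" for t
    proof -
      have "prob_space (extended_family Q t)" using prob by (auto simp: extended_family_def intro!: prob_space_return)
      then have "emeasure (extended_family Q t) (space (extended_family Q t)) = 1" by (rule prob_space.emeasure_space_1)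
      moreover have "space (extended_family Q t) = UNIV" using family_space[OF Q] by (auto simp: extended_family_def)
      ultimately show ?thesis by simp
    qed
    then show ?thesis by simp
  qed
  fix A :: "real set" assume "A \<in> range (\<lambda>a. {..a})"
  then obtain a where A: "A = {..a}" by auto
  have m: "(\<lambda>t. indicator {0..} t * measure (Q t) A) \<in> borel_measurable borel"
  proof (rule borel_measurable_LIMSEQ_real)
    define w where "w n r = max 0 (min 1 (1 - real n * (r - a)))" for n :: nat and r
    have w: "\<bar>w n r\<bar> \<le> 1" "continuous_on UNIV (w n)" for n r
      by (auto simp: w_def intro!: continuous_intros)
    have wl: "(\<lambda>n. w n r) \<longlonglongrightarrow> indicator A r" for r
    proof (cases "r \<le> a")
      case True
      then have "w n r = 1" for n by (simp add: w_def mult_nonneg_nonpos)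
      then show ?thesis using True A by simp
    next
      case False
      then have "filterlim (\<lambda>n. real n * (r - a)) at_top sequentially"
        by (intro filterlim_at_top_mult_tendsto_pos[OF tendsto_const] filterlim_real_sequentially) auto
      then have "\<forall>\<^sub>F n in sequentially. real n * (r - a) \<ge> 1"
        by (simp add: filterlim_at_top)
      then have "\<forall>\<^sub>F n in sequentially. w n r = 0"
        by eventually_elim (simp add: w_def)
      then show ?thesis using False A by (simp add: tendsto_eventually)
    qed
    show "(\<lambda>t. indicator {0..} t * (LINT r|Q t. w n r)) \<in> borel_measurable borel" for n
      using borel_measurable_continuous_on_indicator[OF _ family_mean_continuous[OF Q w(2,1), of n]] by simp
    show "(\<lambda>n. indicator {0..} t * (LINT r|Q t. w n r)) \<longlonglongrightarrow> indicator {0..} t * measure (Q t) A" for t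
    proof (cases "t \<ge> 0")
      case True
      have "(\<lambda>n. LINT r|Q t. w n r) \<longlonglongrightarrow> (LINT r|Q t. indicator A r)"
        by (rule mean_tendsto[OF Q True w(1) wl])
          (auto simp: A intro!: borel_measurable_continuous_onI w(2))
      also have "(LINT r|Q t. indicator A r) = measure (Q t) A"
        using family_sets[OF Q True] A family_space[OF Q True] by simp
      finally show ?thesis using True by simp
    qed simp
  qed
  have "emeasure (extended_family Q t) A = ennreal (indicator {0..} t * measure (Q t) A) + indicator {..<0} t * indicator A 0" for t
    using finite_measure.emeasure_eq_measure[OF family_finite[OF Q], of t A] A
    by (auto simp: extended_family_def indicator_def)
  then show "(\<lambda>t. emeasure (extended_family Q t) A) \<in> borel_measurable borel"
    using m by simp
qed simp

context
  fixes Q :: "real \<Rightarrow> real measure" and \<beta> :: real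
  assumes Q: "weakly_continuous_family Q" and \<beta>: "0 < \<beta>" "\<beta> < 1"
    and eq: "\<And>\<kappa> s. s > 0 \<Longrightarrow> drift_eq \<beta> \<kappa> s (fourier_laplace Q \<kappa> s)"
begin

lemma family_prob: "t \<ge> 0 \<Longrightarrow> prob_space (Q t)"
  using drift_eq_imp_prob[OF Q eq] .

text \<open>
  The law of the position at an independent exponential time of rate \<open>s\<close>, which is \<open>s\<close> times the
  Laplace transform of the family of laws.
\<close>
abbreviation time_mixture :: "real \<Rightarrow> real measure" where
  "time_mixture s \<equiv> exponential s \<bind> extended_family Q"

lemma kernel: "extended_family Q \<in> measurable (exponential s) (subprob_algebra borel)"
  using extended_family_measurable[OF Q family_prob] by simp

lemma kernel_prob: "prob_space (extended_family Q t)"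
  using family_prob by (auto simp: extended_family_def intro!: prob_space_return)

lemma real_distribution_mixture: "s > 0 \<Longrightarrow> real_distribution (time_mixture s)"
  unfolding real_distribution_def real_distribution_axioms_def
  using prob_space.prob_space_bind[OF prob_space_exponential_density _ kernel] kernel_prob
    sets_bind[of "exponential s" "extended_family Q" borel] family_sets[OF Q]
  by (auto simp: extended_family_def)

lemma integral_mixture:
  assumes s: "s > 0" and f: "f \<in> borel_measurable borel" "\<And>r. \<bar>f r\<bar> \<le> B"
  shows "(LINT r|time_mixture s. f r) = s * laplace (\<lambda>t. LINT r|Q t. f r) s"
proof -
  have "(LINT r|time_mixture s. f r) = (LINT t|exponential s. LINT r|extended_family Q t. f r)"
  proof (rule integral_bind[OF f(1) _ kernel])
    show "finite_measure (exponential s)"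
      using prob_space_exponential_density[OF s] by (simp add: prob_space_def)
    show "AE x in exponential s. emeasure (extended_family Q x) (space (extended_family Q x)) \<le> ennreal 1"
      using prob_space.emeasure_space_1[OF kernel_prob] by simp
  qed (rule f)
  also have "\<dots> = s * laplace (\<lambda>t. LINT r|extended_family Q t. f r) s"
    using measurable_compose[OF kernel integral_measurable_subprob_algebra[OF f(1)]] 
    by (intro integral_exponential s) simp
  also have "laplace (\<lambda>t. LINT r|extended_family Q t. f r) s = laplace (\<lambda>t. LINT r|Q t. f r) s"
    unfolding laplace_def by (intro set_lebesgue_integral_cong) (auto simp: extended_family_def)
  finally show ?thesis .
qed

text \<open>
  Multiplying \<open>q0_hat\<close> by \<open>s\<close> gives \<open>a / (a - \<i> \<kappa>)\<close> with \<open>a = s powr \<beta>\<close>, a characteristic function.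
\<close>
lemma time_mixture_eq_exponential:
  assumes s: "s > 0"
  shows "time_mixture s = exponential (s powr \<beta>)"
proof (rule Levy_uniqueness)
  show "real_distribution (time_mixture s)" "real_distribution (exponential (s powr \<beta>))"
    using s by (auto intro: real_distribution_mixture real_distribution_exponential)
  show "char (time_mixture s) = char (exponential (s powr \<beta>))"
  proof
    fix \<kappa>
    have "norm (char (Q t) \<kappa>) \<le> 1" if "t \<ge> 0" for t
      using real_distribution.cmod_char_le_1[of "Q t"] family_prob[OF that] family_sets[OF Q that]
      by (simp add: real_distribution_def real_distribution_axioms_def)
    then have ci: "laplace_integrable (\<lambda>t. char (Q t) \<kappa>) s"
      by (rule laplace_integrable_bounded[OF char_family_continuous[OF Q] _ s])
    have "Re (fourier_laplace Q \<kappa> s) = laplace (\<lambda>t. LINT r|Q t. cos (\<kappa> * r)) s"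
      "Im (fourier_laplace Q \<kappa> s) = laplace (\<lambda>t. LINT r|Q t. sin (\<kappa> * r)) s"
      unfolding fourier_laplace_def Re_Im_laplace(1,2)[OF ci]
      unfolding laplace_def by (auto intro!: set_lebesgue_integral_cong simp: char_family[OF Q])
    moreover have "Re (char (time_mixture s) \<kappa>) = s * laplace (\<lambda>t. LINT r|Q t. cos (\<kappa> * r)) s"
      "Im (char (time_mixture s) \<kappa>) = s * laplace (\<lambda>t. LINT r|Q t. sin (\<kappa> * r)) s"
      unfolding char_real_distribution[OF real_distribution_mixture[OF s]]
      by (rule integral_mixture[OF s, of _ 1]; simp)+
    ultimately have "char (time_mixture s) \<kappa> = of_real s * fourier_laplace Q \<kappa> s"
      by (simp add: complex_eq_iff)
    also have "\<dots> = of_real (s * s powr (\<beta> - 1)) / (of_real (s powr \<beta>) - \<i> * of_real \<kappa>)"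
      using eq[OF s, of \<kappa>] s unfolding drift_eq_iff[OF s] by (simp add: q0_hat_def)
    also have "s * s powr (\<beta> - 1) = s powr \<beta>" using s by (simp add: powr_diff)
    also have "of_real (s powr \<beta>) / (of_real (s powr \<beta>) - \<i> * of_real \<kappa>) = char (exponential (s powr \<beta>)) \<kappa>"
      using s by (simp add: char_exponential)
    finally show "char (time_mixture s) \<kappa> = char (exponential (s powr \<beta>)) \<kappa>" .
  qed
qed

lemma laplace_mean:
  assumes s: "s > 0" and f: "f \<in> borel_measurable borel" "\<And>r. \<bar>f r\<bar> \<le> B"
  shows "s * laplace (\<lambda>t. LINT r|Q t. f r) s = s powr \<beta> * laplace f (s powr \<beta>)"
  using integral_mixture[OF assms] integral_exponential[of "s powr \<beta>" f] f s
  by (simp add: time_mixture_eq_exponential)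

lemma laplace_measure:
  assumes s: "s > 0" and A: "A \<in> sets borel"
  shows "laplace (\<lambda>t. measure (Q t) A) s = (LINT r:A|lborel. q0_tilde \<beta> r s)"
proof -
  have "s * laplace (\<lambda>t. measure (Q t) A) s = s * laplace (\<lambda>t. LINT r|Q t. indicator A r) s"
    unfolding laplace_def using A
    by (intro arg_cong[where f="\<lambda>x. s * x"] set_lebesgue_integral_cong)
      (auto simp: family_sets[OF Q] family_space[OF Q])
  also have "\<dots> = s powr \<beta> * laplace (indicator A) (s powr \<beta>)"
    by (rule laplace_mean[OF s, of _ 1]) (use A in \<open>auto simp: indicator_def\<close>)
  also have "\<dots> = (LINT r|lborel. s * (indicator A r *\<^sub>R q0_tilde \<beta> r s))"
    unfolding laplace_def set_lebesgue_integral_def Bochner_Integration.integral_mult_right_zero[symmetric]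
  proof (rule integral_cong_AE)
    show "AE r in lborel. s powr \<beta> * (indicator {0..} r *\<^sub>R (exp (- (s powr \<beta>) * r) *\<^sub>R indicator A r)) =
      s * (indicator A r *\<^sub>R q0_tilde \<beta> r s)"
      using AE_lborel_singleton[of "0::real"]
    proof eventually_elim
      case (elim r)
      then show ?case using s by (auto simp: indicator_def q0_tilde_def powr_diff mult.commute)
    qed
  qed (use A in \<open>auto simp: q0_tilde_def[abs_def]\<close>)
  finally show ?thesis using s by (simp add: set_lebesgue_integral_def)
qed

text \<open>
  As \<open>s\<close> tends to infinity, \<open>s laplace g s\<close> tends to the value of the pairing at time \<open>0\<close>, while the exponential
  law of rate \<open>s powr \<beta>\<close> concentrates at the origin.
\<close>
lemma initial_value: "Q 0 = return borel 0"
proof (rule Levy_uniqueness)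
  show rd: "real_distribution (Q 0)" "real_distribution (return borel 0)"
    using family_prob[of 0] family_sets[OF Q, of 0]
    by (auto simp: real_distribution_def real_distribution_axioms_def intro: prob_space_return)
  have lim: "(LINT r|Q 0. f r) = f 0" if f: "continuous_on UNIV f" "\<And>r. \<bar>f r\<bar> \<le> 1" for f :: "real \<Rightarrow> real"
  proof -
    let ?g = "\<lambda>t. LINT r|Q t. f r"
    have fm: "f \<in> borel_measurable borel" using f(1) by (rule borel_measurable_continuous_onI)
    have gb: "\<bar>?g t\<bar> \<le> 1" if "t \<ge> 0" for t
      using family_mean_bound[OF Q that f(2) fm] prob_space.prob_space[OF family_prob[OF that]] by simp
    have "(\<lambda>n. real (Suc n) * laplace ?g (real (Suc n))) \<longlonglongrightarrow> ?g 0"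
      by (rule laplace_initial_value[OF family_mean_continuous[OF Q f] gb])
        (auto intro: filterlim_compose[OF filterlim_real_sequentially filterlim_Suc] simp del: of_nat_Suc)
    moreover have "(\<lambda>n. real (Suc n) powr \<beta> * laplace f (real (Suc n) powr \<beta>)) \<longlonglongrightarrow> f 0"
    proof (rule laplace_initial_value[of _ 1])
      show "filterlim (\<lambda>n. real (Suc n) powr \<beta>) at_top sequentially"
        by (rule filterlim_compose[OF real_powr_at_top[OF \<beta>(1)] filterlim_compose[OF filterlim_real_sequentially filterlim_Suc]])
    qed (use f in \<open>auto intro: continuous_on_subset\<close>)
    ultimately show ?thesis
      by (simp only: laplace_mean[OF _ fm f(2)] of_nat_0_less_iff zero_less_Suc LIMSEQ_unique)
  qed
  show "char (Q 0) = char (return borel 0)"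
  proof
    fix \<kappa>
    have "(LINT r|Q 0. cos (\<kappa> * r)) = 1" "(LINT r|Q 0. sin (\<kappa> * r)) = 0"
      using lim[of "\<lambda>r. cos (\<kappa> * r)"] lim[of "\<lambda>r. sin (\<kappa> * r)"]
      by (simp_all add: continuous_on_mult_left continuous_on_cos continuous_on_sin continuous_on_id)
    then have "char (Q 0) \<kappa> = 1"
      by (simp add: complex_eq_iff char_real_distribution[OF rd(1)])
    moreover have "char (return borel 0) \<kappa> = 1"
      by (simp add: char_def integral_return)
    ultimately show "char (Q 0) \<kappa> = char (return borel 0) \<kappa>" by simp
  qed
qed

text \<open>
  Pairing with \<open>\<phi>\<close> amounts to taking the Laplace transform of \<open>\<phi>\<close> in space at \<open>s powr \<beta>\<close>, so the space
  derivative becomes the symbol of the Caputo derivative, and \<open>\<phi> 0\<close> is the initial value.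
\<close>
lemma drift_eq_imp_solves: "solves_fractional_drift \<beta> Q"
  unfolding solves_fractional_drift_def
proof (intro conjI initial_value allI impI)
  fix \<phi> t assume \<phi>: "test_function \<phi>" and "t > (0::real)"
  obtain B B' where d: "\<And>x. (\<phi> has_real_derivative deriv \<phi> x) (at x)"
    and c: "continuous_on UNIV \<phi>" "continuous_on UNIV (deriv \<phi>)"
    and b: "\<And>x. \<bar>\<phi> x\<bar> \<le> B" "\<And>x. \<bar>deriv \<phi> x\<bar> \<le> B'"
    by (rule test_functionD[OF \<phi>]) blast
  let ?g = "\<lambda>t. LINT r|Q t. \<phi> r" and ?h = "\<lambda>t. LINT r|Q t. deriv \<phi> r"
  have m: "\<phi> \<in> borel_measurable borel" "deriv \<phi> \<in> borel_measurable borel"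
    using c by (auto intro: borel_measurable_continuous_onI)
  have cont: "continuous_on {0..} ?g" "continuous_on {0..} ?h"
    using family_mean_continuous[OF Q] c b by blast+
  have g0: "?g 0 = \<phi> 0"
    unfolding initial_value by (rule integral_return) (auto simp: m)
  have bd: "\<bar>?g t\<bar> \<le> B" "\<bar>?h t\<bar> \<le> B'" if "t \<ge> 0" for t
    using family_mean_bound[OF Q that b(1) m(1)] family_mean_bound[OF Q that b(2) m(2)]
      prob_space.prob_space[OF family_prob[OF that]] by simp_all
  have li: "laplace_integrable ?g s" "laplace_integrable ?h s" if "s > 0" for s
    using laplace_integrable_bounded[OF cont(1) _ that, of B] laplace_integrable_bounded[OF cont(2) _ that, of B'] bd
    by simp_all
  have L: "s powr \<beta> * laplace ?g s - s powr (\<beta> - 1) * ?g 0 = laplace ?h s" if s: "s > 0" for s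
  proof -
    have "\<bar>\<phi> x\<bar> \<le> max B B'" "\<bar>deriv \<phi> x\<bar> \<le> max B B'" for x using b[of x] by linarith+
    from laplace_deriv[OF d c(2) this, of "s powr \<beta>"] s
    have ld: "laplace (deriv \<phi>) (s powr \<beta>) = s powr \<beta> * laplace \<phi> (s powr \<beta>) - \<phi> 0" by simp
    have "s * laplace ?h s = s powr \<beta> * (s * laplace ?g s - \<phi> 0)"
      by (simp add: laplace_mean[OF s m(1) b(1)] laplace_mean[OF s m(2) b(2)] ld)
    also have "\<dots> = s * (s powr \<beta> * laplace ?g s - s powr (\<beta> - 1) * ?g 0)"
      using s by (simp add: g0 powr_diff algebra_simps)
    finally show ?thesis using s by simp
  qed
  have "\<forall>t\<ge>0. caputo_integral \<beta> (\<lambda>u. ?g u - ?g 0) t = Gamma (1 - \<beta>) * caputo_integral 0 ?h t"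
    using L by (subst integrated_iff_laplace[OF \<beta> cont li]) auto
  then have "\<forall>t>0. caputo_differentiable \<beta> ?g t \<and> caputo_deriv \<beta> ?g t = ?h t"
    by (subst caputo_iff_integrated[OF \<beta> cont])
  then show "caputo_differentiable \<beta> ?g t" "caputo_deriv \<beta> ?g t = ?h t"
    using \<open>t > 0\<close> by blast+
qed

end

section \<open>Fourier inversion\<close>

definition partial_inverse :: "real \<Rightarrow> real \<Rightarrow> real \<Rightarrow> complex" where
  "partial_inverse a r R = (CLINT \<kappa>:{-R..R}|lborel. exp (- \<i> * of_real \<kappa> * of_real r) / (of_real a - \<i> * of_real \<kappa>))"

lemma denom_nz: "a > 0 \<Longrightarrow> of_real a - \<i> * of_real \<kappa> \<noteq> (0::complex)"
  by (auto simp: complex_eq_iff)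

lemma partial_inverse_integrable:
  assumes "a > 0"
  shows "set_integrable lborel {-R..R} (\<lambda>\<kappa>. exp (- \<i> * of_real \<kappa> * of_real r) / (of_real a - \<i> * of_real \<kappa>) :: complex)"
  by (intro borel_integrable_atLeastAtMost' continuous_intros) (use denom_nz[OF assms] in auto)

lemma norm_denom: "(norm (of_real a - \<i> * of_real \<kappa> :: complex))\<^sup>2 = a\<^sup>2 + \<kappa>\<^sup>2"
  by (simp add: cmod_power2)

lemma norm_numer: "norm (exp (- \<i> * of_real \<kappa> * of_real r) :: complex) = 1"
  by (simp add: norm_exp_eq_Re)

text \<open>
  One integration by parts gains the factor \<open>1 / r\<close> and an integrand of order \<open>1 / (a\<^sup>2 + \<kappa>\<^sup>2)\<close>, hence a
  bound that is uniform in \<open>R\<close>.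
\<close>
lemma partial_inverse_bound:
  assumes a: "a > 0" and r: "r \<noteq> 0" and R: "R \<ge> 0"
  shows "norm (partial_inverse a r R) \<le> (2 + pi) / (a * \<bar>r\<bar>)"
proof -
  let ?e = "\<lambda>\<kappa>. exp (- \<i> * of_real \<kappa> * of_real r) :: complex"
  let ?d = "\<lambda>\<kappa>. of_real a - \<i> * of_real \<kappa> :: complex"
  \<comment> \<open>\<open>F\<close> is the boundary term of the integration by parts, \<open>G\<close> the integrand that remains.\<close>
  define F where "F \<kappa> = \<i> / of_real r * (?e \<kappa> / ?d \<kappa>)" for \<kappa>
  define G where "G \<kappa> = ?e \<kappa> / (of_real r * (?d \<kappa>)\<^sup>2)" for \<kappa>
  have dF: "(F has_vector_derivative ?e \<kappa> / ?d \<kappa> - G \<kappa>) (at \<kappa> within S)" for \<kappa> S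
  proof -
    have alg: "\<i> / r * ((- \<i> * r * e * d - e * (- \<i>)) / (d * d)) = e / d - e / (r * d\<^sup>2)"
      if "r \<noteq> 0" "d \<noteq> 0" for r e d :: complex
    proof -
      have "\<i> * (- \<i> * r * e * d - e * (- \<i>)) = r * e * d - e"
        by (simp add: algebra_simps)
      then have "\<i> / r * ((- \<i> * r * e * d - e * (- \<i>)) / (d * d)) = (r * e * d - e) / (r * (d * d))"
        by (metis times_divide_times_eq)
      then show ?thesis using that by (simp add: diff_divide_distrib power2_eq_square)
    qed
    have "((\<lambda>z. exp (- \<i> * z * of_real r) / (of_real a - \<i> * z)) has_field_derivative
        (- \<i> * of_real r * ?e \<kappa> * ?d \<kappa> - ?e \<kappa> * (- \<i>)) / (?d \<kappa> * ?d \<kappa>)) (at (of_real \<kappa>))"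
      using denom_nz[OF a, of \<kappa>]
      by (intro DERIV_divide) (auto intro!: derivative_eq_intros)
    from DERIV_cmult[OF this, of "\<i> / of_real r"] alg[of "of_real r" "?d \<kappa>" "?e \<kappa>"] denom_nz[OF a, of \<kappa>] r
    have "((\<lambda>z. \<i> / of_real r * (exp (- \<i> * z * of_real r) / (of_real a - \<i> * z))) has_field_derivative ?e \<kappa> / ?d \<kappa> - G \<kappa>) (at (of_real \<kappa>))"
      unfolding G_def by simp
    then show ?thesis
      unfolding F_def by (rule has_vector_derivative_real_field)
  qed
  have contG: "continuous_on S G" for S
    unfolding G_def by (intro continuous_intros) (use denom_nz[OF a] r in auto)
  have iG: "set_integrable lborel {-R..R} G" by (intro borel_integrable_atLeastAtMost' contG)
  have "(CLINT \<kappa>:{-R..R}|lborel. ?e \<kappa> / ?d \<kappa> - G \<kappa>) = F R - F (-R)"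
    unfolding set_lebesgue_integral_def using R
    by (intro integral_FTC_atLeastAtMost dF continuous_intros contG) (use denom_nz[OF a] in auto)
  then have eq: "partial_inverse a r R = F R - F (-R) + (CLINT \<kappa>:{-R..R}|lborel. G \<kappa>)"
    unfolding partial_inverse_def set_integral_diff(2)[OF partial_inverse_integrable[OF a] iG]
    by (rule diff_eq_eq[THEN iffD1])
  have nd: "norm (?d \<kappa>) \<ge> a" for \<kappa>
    using abs_Re_le_cmod[of "?d \<kappa>"] by simp
  have nF: "norm (F \<kappa>) \<le> 1 / (a * \<bar>r\<bar>)" for \<kappa>
  proof -
    have "norm (F \<kappa>) = 1 / (\<bar>r\<bar> * norm (?d \<kappa>))"
      by (simp add: F_def norm_mult norm_divide norm_numer[simplified])
    also have "\<dots> \<le> 1 / (\<bar>r\<bar> * a)"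
      using nd[of \<kappa>] a r by (intro divide_left_mono mult_left_mono mult_pos_pos) auto
    finally show ?thesis by (simp add: mult.commute)
  qed
  have nG: "norm (G \<kappa>) = 1 / \<bar>r\<bar> * (1 / (a\<^sup>2 + \<kappa>\<^sup>2))" for \<kappa>
    by (simp add: G_def norm_mult norm_divide norm_power norm_denom norm_numer[simplified])
  have pos: "a\<^sup>2 + \<kappa>\<^sup>2 \<noteq> 0" for \<kappa> using a by (simp add: sum_power2_eq_zero_iff)
  have i2: "set_integrable lborel {-R..R} (\<lambda>\<kappa>. 1 / \<bar>r\<bar> * (1 / (a\<^sup>2 + \<kappa>\<^sup>2)))"
    by (intro borel_integrable_atLeastAtMost' continuous_intros) (use pos in auto)
  have "norm (CLINT \<kappa>:{-R..R}|lborel. G \<kappa>) \<le> (LINT \<kappa>:{-R..R}|lborel. 1 / \<bar>r\<bar> * (1 / (a\<^sup>2 + \<kappa>\<^sup>2)))"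
    using set_integral_norm_bound[OF iG] by (simp only: nG)
  also have "\<dots> = 1 / \<bar>r\<bar> * (arctan (R / a) / a) - 1 / \<bar>r\<bar> * (arctan (- R / a) / a)"
    unfolding set_lebesgue_integral_def
  proof (rule integral_FTC_atLeastAtMost)
    fix x
    have e: "inverse (1 + (x / a)\<^sup>2) / a / a = 1 / (a\<^sup>2 + x\<^sup>2)"
    proof -
      have "1 + (x / a)\<^sup>2 = (a\<^sup>2 + x\<^sup>2) / a\<^sup>2"
        using a by (simp add: power_divide add_divide_distrib)
      then show ?thesis using a by (simp add: power2_eq_square)
    qed
    have "((\<lambda>x. 1 / \<bar>r\<bar> * (arctan (x / a) / a)) has_real_derivative 1 / \<bar>r\<bar> * (inverse (1 + (x / a)\<^sup>2) / a / a)) (at x within {-R..R})"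
      using a r by (auto intro!: derivative_eq_intros)
    then show "((\<lambda>x. 1 / \<bar>r\<bar> * (arctan (x / a) / a)) has_vector_derivative 1 / \<bar>r\<bar> * (1 / (a\<^sup>2 + x\<^sup>2))) (at x within {-R..R})"
      unfolding e by (simp add: has_real_derivative_iff_has_vector_derivative)
  qed (use R pos r in \<open>auto intro!: continuous_intros\<close>)
  also have "\<dots> = 2 * arctan (R / a) / (a * \<bar>r\<bar>)"
    by (simp add: arctan_minus field_simps)
  also have "\<dots> \<le> pi / (a * \<bar>r\<bar>)"
    using a r arctan_ubound[of "R / a"] by (intro divide_right_mono) auto
  finally have "norm (CLINT \<kappa>:{-R..R}|lborel. G \<kappa>) \<le> pi / (a * \<bar>r\<bar>)" .
  moreover have "norm (partial_inverse a r R) \<le> norm (F R) + norm (F (-R)) + norm (CLINT \<kappa>:{-R..R}|lborel. G \<kappa>)"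
    unfolding eq by (rule order_trans[OF norm_triangle_ineq add_right_mono[OF norm_triangle_ineq4]])
  ultimately show ?thesis
    using nF[of R] nF[of "-R"] by (simp add: add_divide_distrib)
qed

definition exp_tail :: "real \<Rightarrow> real \<Rightarrow> real" where
  "exp_tail a r = (if r > 0 then exp (- a * r) else 0)"

text \<open>
  Levy's inversion formula for a law with characteristic function \<open>\<chi>\<close> integrates \<open>\<chi> \<kappa> / (\<i> \<kappa>)\<close>.  From
  \<open>a / (\<i> \<kappa> (a - \<i> \<kappa>)) = 1 / (\<i> \<kappa>) + 1 / (a - \<i> \<kappa>)\<close>, the formula for the exponential law minus
  the one for the Dirac mass at \<open>0\<close> leaves the integrals of \<open>1 / (a - \<i> \<kappa>)\<close> at the two end points.
\<close>
lemma partial_inverse_diff_tendsto: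
  assumes a: "a > 0" and cb: "c < b" "c \<noteq> 0" "b \<noteq> 0"
  shows "(\<lambda>n::nat. 1 / (2 * pi) * (partial_inverse a c n - partial_inverse a b n)) \<longlonglongrightarrow> of_real (exp_tail a c - exp_tail a b)"
proof -
  let ?h = "\<lambda>t. (iexp (-(t * c)) - iexp (-(t * b))) / (\<i> * t)"
  interpret E: real_distribution "exponential a" by (rule real_distribution_exponential[OF a])
  interpret D: real_distribution "return borel (0::real)"
    by (auto simp: real_distribution_def real_distribution_axioms_def intro: prob_space_return)
  have E0: "measure (exponential a) {x} = 0" for x
    by (simp add: measure_def emeasure_density nn_integral_indicator_singleton AE_lborel_singleton)
  have cdf: "measure (exponential a) {..x} = (if x > 0 then 1 - exp (- a * x) else 0)" for x
    using a by (simp add: measure_def emeasure_erlang_density erlang_CDF_0 not_less)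
  have mE: "measure (exponential a) {c<..b} - measure (return borel 0) {c<..b} = exp_tail a c - exp_tail a b"
  proof -
    have "measure (exponential a) {c<..b} = measure (exponential a) ({..b} - {..c})"
      by (rule arg_cong[of _ _ "measure _"]) auto
    also have "\<dots> = measure (exponential a) {..b} - measure (exponential a) {..c}"
      using cb by (intro E.finite_measure_Diff) auto
    finally show ?thesis
      using cb by (auto simp: cdf exp_tail_def measure_return indicator_def)
  qed
  have LE: "(\<lambda>T::nat. 1 / (2 * pi) * (CLBINT t=-T..T. ?h t * char (exponential a) t)) \<longlonglongrightarrow> measure (exponential a) {c<..b}"
    using cb E0 by (intro E.Levy_Inversion) auto
  have LD: "(\<lambda>T::nat. 1 / (2 * pi) * (CLBINT t=-T..T. ?h t * char (return borel 0) t)) \<longlonglongrightarrow> measure (return borel 0) {c<..b}"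
    using cb by (intro D.Levy_Inversion) (auto simp: measure_return)
  have "1 / (2 * pi) * (CLBINT t=-T..T. ?h t * char (exponential a) t) - 1 / (2 * pi) * (CLBINT t=-T..T. ?h t * char (return borel 0) t)
     = 1 / (2 * pi) * (partial_inverse a c T - partial_inverse a b T)" for T :: nat
  proof -
    have Icc: "(CLBINT t=-T..T. f t) = (CLINT t:{-real T..real T}|lborel. f t)" for f :: "real \<Rightarrow> complex"
      using interval_integral_Icc[of "- real T" "real T" f] by simp
    have i1: "set_integrable lborel {-real T..real T} ?h" 
    proof -
      have "norm (?h t) \<le> b - c" if "t \<noteq> 0" for t
        using Levy_Inversion_aux2[of "-b" "-c" t] cb that by simp
      then show ?thesis
        unfolding set_integrable_def
        by (intro integrableI_bounded_set_indicator[where B="b - c"])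
          (auto intro!: AE_I[of _ _ "{0}"])
    qed
    have i2: "set_integrable lborel {-real T..real T} (\<lambda>\<kappa>. exp (- \<i> * of_real \<kappa> * of_real r) / (of_real a - \<i> * of_real \<kappa>) :: complex)" for r
      by (rule partial_inverse_integrable[OF a])
    have "?h t * char (exponential a) t = ?h t + 
      (exp (- \<i> * of_real t * of_real c) / (of_real a - \<i> * of_real t) - exp (- \<i> * of_real t * of_real b) / (of_real a - \<i> * of_real t))" for t
    proof (cases "t = 0")
      case False
      have "x / (\<i> * t) * (a / d) = x / (\<i> * t) + x / d" if d: "d \<noteq> 0" "d = a - \<i> * t" for x d :: complex
      proof -
        have "a / d = 1 + (\<i> * t) / d" using d by (simp add: divide_simps)
        then show ?thesis using False by (simp add: distrib_left)
      qed
      from this[OF denom_nz[OF a, of t] refl, of "iexp (-(t * c)) - iexp (-(t * b))"] show ?thesis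
        unfolding char_exponential[OF a] by (simp add: diff_divide_distrib mult.assoc)
    qed simp
    then have A: "(CLBINT t=-T..T. ?h t * char (exponential a) t) = 
      (CLINT t:{-real T..real T}|lborel. ?h t) + (partial_inverse a c T - partial_inverse a b T)"
      unfolding Icc partial_inverse_def using i1 i2 by (simp add: set_integral_add set_integral_diff)
    have B: "(CLBINT t=-T..T. ?h t * char (return borel 0) t) = (CLINT t:{-real T..real T}|lborel. ?h t)"
      unfolding Icc by (simp add: char_def integral_return)
    show ?thesis unfolding A B by (simp only: distrib_left add_diff_cancel_left')
  qed
  with tendsto_diff[OF LE LD] mE show ?thesis
    by (simp flip: of_real_diff)
qed

text \<open>
  The second end point moves away from \<open>0\<close> on the side of \<open>c\<close>; the uniform bound makes its contribution
  small before the limit in \<open>n\<close> is taken.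
\<close>
lemma partial_inverse_tendsto_nat:
  assumes a: "a > 0" and c: "c \<noteq> 0"
  shows "(\<lambda>n::nat. 1 / (2 * pi) * partial_inverse a c n) \<longlonglongrightarrow> of_real (exp_tail a c)"
proof (rule LIMSEQ_I)
  fix e :: real assume e: "e > 0"
  define C where "C = (2 + pi) / (2 * pi * a)"
  define b where "b k = c + sgn c * real (Suc k)" for k :: nat
  have babs: "\<bar>b k\<bar> \<ge> real (Suc k)" "b k \<noteq> 0" for k
    using c by (auto simp: b_def sgn_if)
  have bt: "(\<lambda>k. C / \<bar>b k\<bar> + exp_tail a (b k)) \<longlonglongrightarrow> 0 + 0"
  proof (intro tendsto_add)
    have bl: "filterlim (\<lambda>k. \<bar>b k\<bar>) at_top sequentially"
      by (rule filterlim_at_top_mono[OF filterlim_compose[OF filterlim_real_sequentially filterlim_Suc]])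
        (use babs in auto)
    show "(\<lambda>k. C / \<bar>b k\<bar>) \<longlonglongrightarrow> 0"
      by (rule real_tendsto_divide_at_top[OF tendsto_const bl])
    have "(\<lambda>k. exp (- (a * \<bar>b k\<bar>))) \<longlonglongrightarrow> 0"
      by (rule filterlim_compose[OF exp_at_bot])
        (simp add: filterlim_uminus_at_bot filterlim_tendsto_pos_mult_at_top[OF tendsto_const a bl])
    then show "(\<lambda>k. exp_tail a (b k)) \<longlonglongrightarrow> 0"
      by (rule Lim_null_comparison[rotated]) (auto simp: exp_tail_def)
  qed
  have "\<forall>\<^sub>F k in sequentially. C / \<bar>b k\<bar> + exp_tail a (b k) < e / 2"
    by (rule order_tendstoD(2)[OF bt]) (use e in simp)
  then obtain k where k: "C / \<bar>b k\<bar> + exp_tail a (b k) < e / 2"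
    by (blast dest: eventually_happens'[OF sequentially_bot])
  have "(\<lambda>n::nat. 1 / (2 * pi) * (partial_inverse a c n - partial_inverse a (b k) n)) \<longlonglongrightarrow> of_real (exp_tail a c - exp_tail a (b k))"
  proof (cases "c > 0")
    case True
    then show ?thesis using partial_inverse_diff_tendsto[OF a, of c "b k"] babs by (simp add: b_def)
  next
    case False
    then have "b k < c" using c by (simp add: b_def)
    then have "(\<lambda>n::nat. - (1 / (2 * pi) * (partial_inverse a (b k) n - partial_inverse a c n))) \<longlonglongrightarrow> - of_real (exp_tail a (b k) - exp_tail a c)"
      using c babs by (intro tendsto_minus partial_inverse_diff_tendsto[OF a]) auto
    then show ?thesis by (simp add: algebra_simps)
  qed
  from LIMSEQ_D[OF this half_gt_zero[OF e]] obtain N where N: "\<And>n::nat. n \<ge> N \<Longrightarrow>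
    norm (1 / (2 * pi) * (partial_inverse a c n - partial_inverse a (b k) n) - of_real (exp_tail a c - exp_tail a (b k))) < e / 2"
    by blast
  show "\<exists>N. \<forall>n\<ge>N. norm (1 / (2 * pi) * partial_inverse a c (real n) - of_real (exp_tail a c)) < e"
  proof (intro exI[of _ N] allI impI)
    fix n assume n: "n \<ge> N"
    let ?x = "1 / (2 * pi) * (partial_inverse a c n - partial_inverse a (b k) n) - of_real (exp_tail a c - exp_tail a (b k))"
    have "1 / (2 * pi) * partial_inverse a c n - of_real (exp_tail a c) =
       ?x + (1 / (2 * pi) * partial_inverse a (b k) n - of_real (exp_tail a (b k)))"
      by (simp add: algebra_simps)
    also have "norm \<dots> \<le> norm ?x + (norm (1 / (2 * pi) * partial_inverse a (b k) n) + norm (of_real (exp_tail a (b k)) :: complex))"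
      by (rule order_trans[OF norm_triangle_ineq add_left_mono[OF norm_triangle_ineq4]])
    also have "norm (1 / (2 * pi) * partial_inverse a (b k) n) \<le> C / \<bar>b k\<bar>"
    proof -
      have "norm (1 / (2 * pi) * partial_inverse a (b k) n) = 1 / (2 * pi) * norm (partial_inverse a (b k) n)"
        by (simp add: norm_mult norm_divide)
      also have "\<dots> \<le> 1 / (2 * pi) * ((2 + pi) / (a * \<bar>b k\<bar>))"
        using partial_inverse_bound[OF a babs(2), of n k] by (intro mult_left_mono) auto
      finally show ?thesis by (simp add: C_def mult.assoc)
    qed
    also have "norm (of_real (exp_tail a (b k)) :: complex) = exp_tail a (b k)"
      by (simp add: exp_tail_def)
    finally show "norm (1 / (2 * pi) * partial_inverse a c (real n) - of_real (exp_tail a c)) < e"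
      using N[OF n] k by linarith
  qed
qed

text \<open>
  Levy's formula is a limit along the integers; beyond \<open>n\<close> the integrand is at most \<open>1 / n\<close>, so the
  fractional part of \<open>R\<close> does not matter in the limit.
\<close>
lemma partial_inverse_floor:
  assumes a: "a > 0" and R: "R \<ge> 1"
  shows "norm (partial_inverse a c R - partial_inverse a c (real (nat \<lfloor>R\<rfloor>))) \<le> 2 / real (nat \<lfloor>R\<rfloor>)"
proof -
  define n where "n = real (nat \<lfloor>R\<rfloor>)"
  have n: "1 \<le> n" "n \<le> R" "R \<le> n + 1"
    using R by (auto simp: n_def le_nat_iff le_floor_iff)
  let ?f = "\<lambda>\<kappa>. exp (- \<i> * of_real \<kappa> * of_real c) / (of_real a - \<i> * of_real \<kappa>) :: complex"
  have i: "integrable lborel (\<lambda>\<kappa>. indicator {-R..R} \<kappa> *\<^sub>R ?f \<kappa>)" "integrable lborel (\<lambda>\<kappa>. indicator {-n..n} \<kappa> *\<^sub>R ?f \<kappa>)"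
    using partial_inverse_integrable[OF a, of R c] partial_inverse_integrable[OF a, of n c]
    by (simp_all only: set_integrable_def)
  have j: "integrable lborel (\<lambda>\<kappa>::real. indicator {-R..R} \<kappa> :: real)" "integrable lborel (\<lambda>\<kappa>::real. indicator {-n..n} \<kappa> :: real)"
    using n R by (auto intro!: integrable_real_indicator)
  have eq: "partial_inverse a c R - partial_inverse a c n =
    (CLINT \<kappa>|lborel. indicator {-R..R} \<kappa> *\<^sub>R ?f \<kappa> - indicator {-n..n} \<kappa> *\<^sub>R ?f \<kappa>)"
    unfolding partial_inverse_def set_lebesgue_integral_def
    by (rule Bochner_Integration.integral_diff[OF i, symmetric])
  have "norm (partial_inverse a c R - partial_inverse a c n) \<le> (LINT \<kappa>|lborel. 1 / n * (indicator {-R..R} \<kappa> - indicator {-n..n} \<kappa>))"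
    unfolding eq
  proof (rule Bochner_Integration.integral_norm_bound_integral)
    fix \<kappa> :: real
    have "norm (?f \<kappa>) \<le> 1 / n" if "\<bar>\<kappa>\<bar> > n"
    proof -
      have "n \<le> norm (of_real a - \<i> * of_real \<kappa> :: complex)"
        using abs_Im_le_cmod[of "of_real a - \<i> * of_real \<kappa>"] that by simp
      then have "1 / norm (of_real a - \<i> * of_real \<kappa> :: complex) \<le> 1 / n"
        using n by (intro frac_le) auto
      then show ?thesis
        by (simp only: norm_divide norm_numer)
    qed
    then show "norm (indicator {-R..R} \<kappa> *\<^sub>R ?f \<kappa> - indicator {-n..n} \<kappa> *\<^sub>R ?f \<kappa>) \<le> 1 / n * (indicator {-R..R} \<kappa> - indicator {-n..n} \<kappa>)"
      using n by (cases "\<bar>\<kappa>\<bar> > n") (auto simp: indicator_def abs_le_iff not_less split: if_splits)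
  next
    show "integrable lborel (\<lambda>\<kappa>. indicator {-R..R} \<kappa> *\<^sub>R ?f \<kappa> - indicator {-n..n} \<kappa> *\<^sub>R ?f \<kappa>)"
      by (rule Bochner_Integration.integrable_diff[OF i])
    show "integrable lborel (\<lambda>\<kappa>. 1 / n * (indicator {-R..R} \<kappa> - indicator {-n..n} \<kappa>))"
      by (intro integrable_mult_right Bochner_Integration.integrable_diff j)
  qed
  also have "\<dots> = 1 / n * (2 * R - 2 * n)"
  proof -
    have "(LINT \<kappa>|lborel. indicator {-R..R} \<kappa> - indicator {-n..n} \<kappa>) = 2 * R - 2 * n"
      unfolding Bochner_Integration.integral_diff[OF j] using n R by simp
    then show ?thesis by (simp only: integral_mult_right_zero)
  qed
  also have "\<dots> \<le> 1 / n * 2" using n by (intro mult_left_mono) auto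
  finally show ?thesis by (simp add: n_def)
qed

lemma partial_inverse_tendsto:
  assumes a: "a > 0" and c: "c \<noteq> 0"
  shows "((\<lambda>R. 1 / (2 * pi) * partial_inverse a c R) \<longlongrightarrow> of_real (exp_tail a c)) at_top"
proof -
  let ?n = "\<lambda>R::real. nat \<lfloor>R\<rfloor>"
  have nl: "filterlim ?n sequentially at_top"
    by (intro filterlim_compose[OF filterlim_nat_sequentially] filterlim_floor_sequentially)
  have 1: "((\<lambda>R. 1 / (2 * pi) * partial_inverse a c (real (?n R))) \<longlongrightarrow> of_real (exp_tail a c)) at_top"
    by (rule filterlim_compose[OF partial_inverse_tendsto_nat[OF a c] nl])
  have "((\<lambda>R. partial_inverse a c R - partial_inverse a c (real (?n R))) \<longlongrightarrow> 0) at_top"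
  proof (rule Lim_null_comparison)
    show "\<forall>\<^sub>F R in at_top. norm (partial_inverse a c R - partial_inverse a c (real (?n R))) \<le> 2 / real (?n R)"
      using eventually_ge_at_top[of 1] by eventually_elim (rule partial_inverse_floor[OF a])
    show "((\<lambda>R. 2 / real (?n R)) \<longlongrightarrow> 0) at_top"
      by (rule real_tendsto_divide_at_top[OF tendsto_const filterlim_compose[OF filterlim_real_sequentially nl]])
  qed
  from tendsto_add[OF 1 tendsto_mult[OF tendsto_const[of "1 / (2 * of_real pi) :: complex"] this]] show ?thesis
    by (simp add: right_diff_distrib diff_divide_distrib)
qed

lemma q0_hat_has_fourier_inverse:
  assumes s: "s > 0" and r: "r \<noteq> 0"
  shows "has_fourier_inverse (\<lambda>\<kappa>. q0_hat \<beta> \<kappa> s) r (of_real (q0_tilde \<beta> r s))"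
proof -
  let ?p = "of_real (s powr (\<beta> - 1)) :: complex"
  have "((\<lambda>R. ?p * (1 / (2 * pi) * partial_inverse (s powr \<beta>) r R)) \<longlongrightarrow> ?p * of_real (exp_tail (s powr \<beta>) r)) at_top"
    using s by (intro tendsto_mult tendsto_const partial_inverse_tendsto r) auto
  moreover have "?p * of_real (exp_tail (s powr \<beta>) r) = of_real (q0_tilde \<beta> r s)"
    by (auto simp: exp_tail_def q0_tilde_def mult.commute)
  moreover have "?p * (1 / (2 * pi) * partial_inverse (s powr \<beta>) r R) =
     1 / (2 * of_real pi) * (CLINT \<kappa>:{-R..R}|lborel. exp (- \<i> * of_real \<kappa> * of_real r) * q0_hat \<beta> \<kappa> s)" for R
  proof -
    have "(CLINT \<kappa>:{-R..R}|lborel. exp (- \<i> * of_real \<kappa> * of_real r) * q0_hat \<beta> \<kappa> s) =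
       (CLINT \<kappa>:{-R..R}|lborel. ?p * (exp (- \<i> * of_real \<kappa> * of_real r) / (of_real (s powr \<beta>) - \<i> * of_real \<kappa>)))"
      by (simp add: q0_hat_def mult.commute)
    also have "\<dots> = ?p * partial_inverse (s powr \<beta>) r R"
      unfolding partial_inverse_def by (rule set_integral_mult_right)
    finally show ?thesis by simp
  qed
  ultimately show ?thesis by (simp add: has_fourier_inverse_def)
qed

section \<open>The scaled renewal equation\<close>

lemma scaled_renewal_eq_iff:
  assumes "\<delta> > 0" "s > 0"
  shows "scaled_renewal_eq \<beta> \<delta> \<kappa> s x \<longleftrightarrow>
    x = of_real (s powr (\<beta> - 1)) / (of_real (s powr \<beta>) - (exp (\<i> * of_real \<kappa> * of_real \<delta>) - 1) / of_real \<delta>)"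
proof -
  define c where "c = (exp (\<i> * of_real \<kappa> * of_real \<delta>) - 1) / (of_real \<delta> :: complex)"
  have "Re c = (cos (\<kappa> * \<delta>) - 1) / \<delta>"
    unfolding c_def Re_divide_of_real by (simp add: Re_exp)
  also have "\<dots> \<le> 0" using assms by (intro divide_nonpos_pos) auto
  finally have "Re c \<le> 0" .
  moreover have "s powr \<beta> > 0" using assms by simp
  ultimately have "Re (of_real (s powr \<beta>) - c) > 0" unfolding minus_complex.sel Re_complex_of_real by linarith
  then have ne: "of_real (s powr \<beta>) - c \<noteq> 0" by (metis less_irrefl zero_complex.sel(1))
  have "of_real (s powr (\<beta> - 1)) * of_real s = (of_real (s powr \<beta>) :: complex)"
    using assms by (simp add: powr_diff)
  then have "scaled_renewal_eq \<beta> \<delta> \<kappa> s x \<longleftrightarrow> of_real (s powr \<beta>) * x - of_real (s powr (\<beta> - 1)) = c * x"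
    by (simp add: scaled_renewal_eq_def c_def right_diff_distrib divide_inverse mult.commute[of _ "inverse _"] flip: mult.assoc)
  also have "\<dots> \<longleftrightarrow> x = of_real (s powr (\<beta> - 1)) / (of_real (s powr \<beta>) - c)"
    using ne by (auto simp: field_simps)
  finally show ?thesis by (simp add: c_def)
qed

lemma scaled_symbol_tendsto:
  "((\<lambda>\<delta>. (exp (\<i> * of_real \<kappa> * of_real \<delta>) - 1) / of_real \<delta>) \<longlongrightarrow> \<i> * of_real \<kappa>) (at_right (0::real))"
proof -
  have "((\<lambda>z. exp (\<i> * of_real \<kappa> * z)) has_field_derivative \<i> * of_real \<kappa>) (at 0)"
    by (auto intro!: derivative_eq_intros)
  then have "((\<lambda>z. (exp (\<i> * of_real \<kappa> * z) - 1) / z) \<longlongrightarrow> \<i> * of_real \<kappa>) (at 0)"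
    by (simp add: has_field_derivative_iff)
  moreover have "filterlim (\<lambda>\<delta>::real. of_real \<delta> :: complex) (at 0) (at_right 0)"
    unfolding filterlim_at
    by (auto intro!: tendsto_eq_intros eventually_at_rightI[of 0 1])
  ultimately show ?thesis by (rule filterlim_compose)
qed

lemma scaled_solution_tendsto:
  assumes q: "\<And>\<delta>. \<delta> > 0 \<Longrightarrow> scaled_renewal_eq \<beta> \<delta> \<kappa> s (q \<delta>)" and s: "s > 0"
  shows "(q \<longlongrightarrow> q0_hat \<beta> \<kappa> s) (at_right 0)"
proof -
  have "of_real (s powr \<beta>) - \<i> * of_real \<kappa> \<noteq> (0::complex)"
    using s by (auto simp: complex_eq_iff)
  then have "((\<lambda>\<delta>. of_real (s powr (\<beta> - 1)) / (of_real (s powr \<beta>) - (exp (\<i> * of_real \<kappa> * of_real \<delta>) - 1) / of_real \<delta>))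
      \<longlongrightarrow> q0_hat \<beta> \<kappa> s) (at_right 0)"
    unfolding q0_hat_def by (intro tendsto_intros scaled_symbol_tendsto)
  then show ?thesis
    by (rule Lim_transform_eventually)
      (use q s scaled_renewal_eq_iff in \<open>auto intro!: eventually_at_rightI[of 0 1]\<close>)
qed

theorem mainTheorem4:
  fixes \<beta> :: real and q :: "real \<Rightarrow> real \<Rightarrow> real \<Rightarrow> complex"
  assumes "0 < \<beta>" and "\<beta> < 1"
    and q: "\<And>\<delta> \<kappa> s. \<delta> > 0 \<Longrightarrow> s > 0 \<Longrightarrow> scaled_renewal_eq \<beta> \<delta> \<kappa> s (q \<delta> \<kappa> s)"
  shows "(\<forall>\<delta>>0. \<forall>\<kappa>. \<forall>s>0. \<exists>!x. scaled_renewal_eq \<beta> \<delta> \<kappa> s x)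
    \<and> (\<forall>\<kappa>. \<forall>s>0. ((\<lambda>\<delta>. q \<delta> \<kappa> s) \<longlongrightarrow> q0_hat \<beta> \<kappa> s) (at_right 0))
    \<and> (\<forall>\<kappa>. \<forall>s>0. drift_eq \<beta> \<kappa> s (q0_hat \<beta> \<kappa> s))
    \<and> (\<forall>Q. weakly_continuous_family Q \<longrightarrow>
          (solves_fractional_drift \<beta> Q \<longleftrightarrow>
             (\<forall>\<kappa>. \<forall>s>0. drift_eq \<beta> \<kappa> s (fourier_laplace Q \<kappa> s))))
    \<and> (\<forall>s>0. \<forall>r. r \<noteq> 0 \<longrightarrow>
          has_fourier_inverse (\<lambda>\<kappa>. q0_hat \<beta> \<kappa> s) r (of_real (q0_tilde \<beta> r s)))
    \<and> (\<forall>Q. weakly_continuous_family Q \<and> solves_fractional_drift \<beta> Q \<longrightarrow>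
          (\<forall>s>0. \<forall>A\<in>sets borel.
             laplace (\<lambda>t. measure (Q t) A) s = (LINT r:A|lborel. q0_tilde \<beta> r s)))"
proof (intro conjI allI impI ballI)
  fix \<delta> \<kappa> s :: real assume "\<delta> > 0" "s > 0"
  then show "\<exists>!x. scaled_renewal_eq \<beta> \<delta> \<kappa> s x" by (simp add: scaled_renewal_eq_iff)
next
  fix \<kappa> s :: real assume "s > 0"
  then show "((\<lambda>\<delta>. q \<delta> \<kappa> s) \<longlongrightarrow> q0_hat \<beta> \<kappa> s) (at_right 0)"
    using q by (intro scaled_solution_tendsto)
next
  fix \<kappa> s :: real assume "s > 0"
  then show "drift_eq \<beta> \<kappa> s (q0_hat \<beta> \<kappa> s)" by (simp add: drift_eq_iff)
next
  fix Q assume Q: "weakly_continuous_family Q"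
  show "solves_fractional_drift \<beta> Q \<longleftrightarrow> (\<forall>\<kappa>. \<forall>s>0. drift_eq \<beta> \<kappa> s (fourier_laplace Q \<kappa> s))"
    using solves_imp_drift_eq[OF Q assms(1,2)] drift_eq_imp_solves[OF Q assms(1,2)] by blast
next
  fix s r :: real assume "s > 0" "r \<noteq> 0"
  then show "has_fourier_inverse (\<lambda>\<kappa>. q0_hat \<beta> \<kappa> s) r (of_real (q0_tilde \<beta> r s))"
    by (rule q0_hat_has_fourier_inverse)
next
  fix Q and s :: real and A :: "real set"
  assume "weakly_continuous_family Q \<and> solves_fractional_drift \<beta> Q" "s > 0" "A \<in> sets borel"
  then show "laplace (\<lambda>t. measure (Q t) A) s = (LINT r:A|lborel. q0_tilde \<beta> r s)"
    using laplace_measure[of Q \<beta>] solves_imp_drift_eq[of Q \<beta>] assms(1,2) by blast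
qed

end
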